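(* Let $0<\alpha,\beta<1/2$ be fixed, let $x_0\in(0,1)$ be fixed, and for $0<\nu<1$ let $q_\nu$ denote the $\nu$-quantile of the standard normal distribution $\mathcal N(0,1)$. Let $n=n_t\in\mathbb N$ with $n_t\to\infty$ as $t\to\infty$ ($t\in\mathbb N$). For the model under consideration let $d=d_t\in(0,1)$ denote the statistical resolution (defined in the context) at the point $x_0$ with discretization $n$, exposure time $t$, type I error $\alpha$ and type II error $\beta$, with corresponding source positions $x_1,x_2\in(0,1)$, $|x_1-x_2|=d$, $x_0=(x_1+x_2)/2$, and suppose $d\to0$ as $t\to\infty$. (a) (Poisson model) Let $F_{t\theta}=\mathrm{Poi}(t\theta)$. Suppose that $h$ is even and non-constant, that $h>0$, and that $h(\cdot-x_i)\in C^4[0,1]$ for all $i\in\{0,1,2\}$. Then $$d\asymp 2\sqrt2\,\sqrt{q_{1-\beta}-q_\alpha}\left(\int_0^1\frac{h''(x-x_0)^2}{h(x-x_0)}\,dx\right)^{-1/4}t^{-1/4}.$$ (b) (Variance stabilized Gaussian model) Let the distribution of $Y_i$ be $\mathcal N(2\sqrt{t\theta},1)$ with $\theta=\int_{B_i}g(x)\,dx$. Under the same conditions on $h$ as in (a) (that is, $h$ is even and non-constant, $h>0$, $h(\cdot-x_i)\in C^4[0,1]$ for all $i\in\{0,1,2\}$), the same asymptotic relation $$d\asymp 2\sqrt2\,\sqrt{q_{1-\beta}-q_\alpha}\left(\int_0^1\frac{h''(x-x_0)^2}{h(x-x_0)}\,dx\right)^{-1/4}t^{-1/4}$$ holds. (c)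 (Homogeneous Gaussian model) Let $F_{t\theta}=\mathcal N(t\theta,1)$ and $n=o(t^2)$. Suppose that $h$ is even and non-constant, that $h\ge0$, and that $h(\cdot-x_i)\in C^2[0,1]$ for all $i\in\{0,1,2\}$. Then $$d\asymp 2\sqrt2\,\sqrt{q_{1-\beta}-q_\alpha}\left(\int_0^1h''(x-x_0)^2\,dx\right)^{-1/4}t^{-1/2}\,n^{1/4}.$$
   Context: Notation: $a_t\asymp b_t$ means $\lim_{t\to\infty}a_t/b_t=1$. All parameters are coupled to $t$: $n=n_t$, $d=d_t$, and $x_1,x_2$ depend on $t$, while $x_0$ and $h$ are fixed. Point spread function: $h:\mathbb R\to[0,\infty)$ is a fixed function; "even" means $h(-x)=h(x)$. The shifts $h(\cdot-x_i)$ are regarded as functions on $[0,1]$; conditions of the form $h(\cdot-x_i)\in C^k[0,1]$ and positivity are required for $x_0$ and for all alternatives $x_1,x_2$ considered; non-constancy of $h$ refers to the function $h(\cdot-x_0)$ on $[0,1]$. Model: for $i=1,\dots,n$ let $B_i=[(i-1)/n,i/n]$. For an image function $g$ on $[0,1]$ one observes independent random variables $Y_1,\dots,Y_n$, where with $\theta_i=\int_{B_i}g(x)\,dx$ the law of $Y_i$ is: $\mathrm{Poi}(t\theta_i)$ in the Poisson model; $\mathcal N(2\sqrt{t\theta_i},1)$ in the variance stabilized Gaussian (VSG) model; $\mathcal N(t\theta_i,1)$ in the homogeneous Gaussian (HG) model. Testing problem: for given $x_0,x_1,x_2$, the simple hypothesis $H_0: g(x)=h(x-x_0)$ is tested against the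 simple alternative $H_1: g(x)=\tfrac12h(x-x_1)+\tfrac12h(x-x_2)$, from $Y=(Y_1,\dots,Y_n)$. A (randomized) test is a measurable map $\Psi:\mathbb R^n\to[0,1]$ ($\Psi(Y)$ is the probability of rejecting $H_0$); its level is $\mathbb E_{H_0}[\Psi(Y)]$ and its power is $\mathbb E_{H_1}[\Psi(Y)]$. By the Neyman–Pearson lemma the most powerful test at a given level is a (possibly randomized) likelihood ratio test. Statistical resolution: for fixed $\alpha,\beta\in(0,1/2)$, $x_0\in[0,1]$, $t,n\in\mathbb N$ and one of the three models, the statistical resolution at $x_0$, discretization $n$, exposure time $t$, type I error $\alpha$, type II error $\beta$ is the unique $d\in(0,1)$ such that the most powerful test $\Psi^*$ (the likelihood ratio test) for $H_0$ against $H_1$ with $x_1,x_2$ chosen so that $|x_1-x_2|=d$ and $x_0=\frac12(x_1+x_2)$ has exactly level $\alpha$ and power $1-\beta$, i.e. $\mathbb E_{H_0}[\Psi^*(Y)]=\alpha$ and $\mathbb E_{H_1}[\Psi^*(Y)]=1-\beta$. *)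

theory Defs
  imports "HOL-Probability.Probability" "HOL-Library.Landau_Symbols"
begin

text \<open>
  Derivatives are taken within \<open>S\<close>, so at the endpoints of a compact interval they are
  one-sided. The function \<open>D j\<close> plays the role of the \<open>j\<close>-th derivative.
\<close>

definition Ck_on :: "nat \<Rightarrow> (real \<Rightarrow> real) \<Rightarrow> real set \<Rightarrow> bool" where
  "Ck_on k f S \<longleftrightarrow>
     (\<exists>D :: nat \<Rightarrow> real \<Rightarrow> real.
        (\<forall>x\<in>S. D 0 x = f x) \<and>
        (\<forall>j<k. \<forall>x\<in>S. (D j has_real_derivative D (Suc j) x) (at x within S)) \<and>
        (\<forall>j\<le>k. continuous_on S (D j)))"

definition std_normal_quantile :: "real \<Rightarrow> real" where
  "std_normal_quantile \<nu> = (THE q. cdf (density lborel std_normal_density) q = \<nu>)"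

definition bin :: "nat \<Rightarrow> nat \<Rightarrow> real set" where
  "bin n i = {(real i - 1) / real n .. real i / real n}"

definition bin_intensity :: "nat \<Rightarrow> (real \<Rightarrow> real) \<Rightarrow> nat \<Rightarrow> real" where
  "bin_intensity n g i = integral (bin n i) g"

datatype model = Poisson | Variance_Stabilized_Gaussian | Homogeneous_Gaussian

text \<open>
  The library's \<open>poisson_pmf\<close> is only specified for positive rates; \<open>Poi(0)\<close> is the
  point mass at \<open>0\<close>.
\<close>

definition poisson_law :: "real \<Rightarrow> real measure" where
  "poisson_law r =
     distr (measure_pmf (if r = 0 then return_pmf 0 else poisson_pmf r)) borel real"

fun bin_law :: "model \<Rightarrow> nat \<Rightarrow> real \<Rightarrow> real measure" where
  "bin_law Poisson t \<theta> = poisson_law (real t * \<theta>)"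
| "bin_law Variance_Stabilized_Gaussian t \<theta> =
     density lborel (normal_density (2 * sqrt (real t * \<theta>)) 1)"
| "bin_law Homogeneous_Gaussian t \<theta> = density lborel (normal_density (real t * \<theta>) 1)"

definition data_law :: "model \<Rightarrow> nat \<Rightarrow> nat \<Rightarrow> (real \<Rightarrow> real) \<Rightarrow> (nat \<Rightarrow> real) measure" where
  "data_law m n t g = Pi\<^sub>M {1..n} (\<lambda>i. bin_law m t (bin_intensity n g i))"

definition randomized_test :: "nat \<Rightarrow> ((nat \<Rightarrow> real) \<Rightarrow> real) \<Rightarrow> bool" where
  "randomized_test n \<Psi> \<longleftrightarrow>
     \<Psi> \<in> borel_measurable (Pi\<^sub>M {1..n} (\<lambda>_. borel)) \<and>
     (\<forall>y\<in>space (Pi\<^sub>M {1..n} (\<lambda>_. borel :: real measure)). 0 \<le> \<Psi> y \<and> \<Psi> y \<le> 1)"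

definition most_powerful_test ::
  "nat \<Rightarrow> (nat \<Rightarrow> real) measure \<Rightarrow> (nat \<Rightarrow> real) measure \<Rightarrow> real \<Rightarrow> ((nat \<Rightarrow> real) \<Rightarrow> real) \<Rightarrow> bool"
where
  "most_powerful_test n P0 P1 \<alpha> \<Psi> \<longleftrightarrow>
     randomized_test n \<Psi> \<and> (\<integral>y. \<Psi> y \<partial>P0) \<le> \<alpha> \<and>
     (\<forall>\<Phi>. randomized_test n \<Phi> \<longrightarrow> (\<integral>y. \<Phi> y \<partial>P0) \<le> \<alpha> \<longrightarrow>
          (\<integral>y. \<Phi> y \<partial>P1) \<le> (\<integral>y. \<Psi> y \<partial>P1))"

definition null_image :: "(real \<Rightarrow> real) \<Rightarrow> real \<Rightarrow> real \<Rightarrow> real" where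
  "null_image h x0 = (\<lambda>x. h (x - x0))"

definition alternative_image :: "(real \<Rightarrow> real) \<Rightarrow> real \<Rightarrow> real \<Rightarrow> real \<Rightarrow> real" where
  "alternative_image h x1 x2 = (\<lambda>x. h (x - x1) / 2 + h (x - x2) / 2)"

definition attains_errors ::
  "model \<Rightarrow> (real \<Rightarrow> real) \<Rightarrow> real \<Rightarrow> nat \<Rightarrow> nat \<Rightarrow> real \<Rightarrow> real \<Rightarrow> real \<Rightarrow> bool"
where
  "attains_errors m h x0 n t \<alpha> \<beta> d \<longleftrightarrow>
     (\<exists>x1 x2 \<Psi>. \<bar>x1 - x2\<bar> = d \<and> x0 = (x1 + x2) / 2 \<and>
        most_powerful_test n (data_law m n t (null_image h x0))
          (data_law m n t (alternative_image h x1 x2)) \<alpha> \<Psi> \<and>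
        (\<integral>y. \<Psi> y \<partial>data_law m n t (null_image h x0)) = \<alpha> \<and>
        (\<integral>y. \<Psi> y \<partial>data_law m n t (alternative_image h x1 x2)) = 1 - \<beta>)"

definition is_statistical_resolution ::
  "model \<Rightarrow> (real \<Rightarrow> real) \<Rightarrow> real \<Rightarrow> nat \<Rightarrow> nat \<Rightarrow> real \<Rightarrow> real \<Rightarrow> real \<Rightarrow> bool"
where
  "is_statistical_resolution m h x0 n t \<alpha> \<beta> d \<longleftrightarrow>
     d \<in> {0<..<1} \<and> attains_errors m h x0 n t \<alpha> \<beta> d \<and>
     (\<forall>d'\<in>{0<..<1}. attains_errors m h x0 n t \<alpha> \<beta> d' \<longrightarrow> d' = d)"

end

theory Submission
  imports Defs
begin

text \<open>
  All three models are exponential families in the observations, so the log-likelihood ratio of the two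
  images is a linear statistic \<open>\<Sum> r\<^sub>i Y\<^sub>i\<close> up to a constant. After normalization it is asymptotically
  standard normal under the null image, and it is a standard normal shifted by \<open>s\<close> under the
  alternative, where \<open>s\<^sup>2\<close> is the variance of the log-likelihood ratio. A most powerful test of
  level \<open>\<alpha>\<close> then has power close to \<open>1 - \<beta>\<close> only if \<open>s\<close> is close to \<open>q\<^sub>1\<^sub>-\<^sub>\<beta> - q\<^sub>\<alpha>\<close>. This is
  \<open>most_powerful_shift_limit\<close>. Its proof compares the given most powerful test with two threshold
  tests whose levels lie slightly above and slightly below \<open>\<alpha>\<close>; since the levels only have to
  enclose \<open>\<alpha>\<close>, atoms of the Poisson statistic are harmless. The normal limits come from
  characteristic functions and Levy's continuity theorem. In the Gaussian models the statistic
  is itself normal; in the Poisson model the remainder is a third moment, of the order of the largest normalized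
  weight \<open>r\<^sub>i / s\<close>.

  It remains to compute \<open>s\<close>. Splitting the source at \<open>x0\<close> symmetrically adds a second difference to the
  image, which is \<open>\<eta> G\<close> up to an error uniformly of smaller order than \<open>\<eta>\<close>, with
  \<open>\<eta> = d\<^sup>2 / 8\<close> and \<open>G x = h'' (x - x0)\<close>. Bin averages of the image \<open>f\<close> and of the direction \<open>G\<close>
  converge uniformly to the functions themselves, because the bin width tends to zero. Hence each sum over bins is a Riemann sum of
  a continuous function of the triple \<open>(\<eta>, f, G)\<close>, and it converges to the integral of the value at
  \<open>\<eta> = 0\<close>. This gives \<open>s\<^sup>2 \<sim> t \<eta>\<^sup>2 \<integral> G\<^sup>2 / f\<close> in the Poisson and in the variance stabilized model,
  and \<open>s\<^sup>2 \<sim> (t\<^sup>2 / n) \<eta>\<^sup>2 \<integral> G\<^sup>2\<close> in the homogeneous one. These limits are \<open>poisson_limit\<close>,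
  \<open>variance_stabilized_gaussian_limit\<close> and \<open>homogeneous_gaussian_limit\<close>. Solving
  \<open>s \<longlongrightarrow> q\<^sub>1\<^sub>-\<^sub>\<beta> - q\<^sub>\<alpha>\<close> for \<open>d\<close> yields the three rates. The integrals are positive because an even \<open>h\<close>
  with \<open>h'' = 0\<close> on an interval around \<open>0\<close> is constant there.
\<close>

section \<open>The standard normal distribution function\<close>

lemma std_normal_atomless: "measure std_normal_distribution {x} = 0"
  by (simp add: measure_def emeasure_density)

lemma std_normal_cdf_isCont: "isCont (cdf std_normal_distribution) x"
proof -
  interpret real_distribution std_normal_distribution by (rule real_dist_normal_dist)
  show ?thesis by (simp add: isCont_cdf std_normal_atomless)
qed

lemma std_normal_cdf_strict_mono: "strict_mono (cdf std_normal_distribution)"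
proof (rule strict_monoI)
  interpret real_distribution std_normal_distribution by (rule real_dist_normal_dist)
  fix a b :: real assume ab: "a < b"
  have "emeasure std_normal_distribution {a<..b} \<noteq> 0"
  proof
    assume "emeasure std_normal_distribution {a<..b} = 0"
    then have "{a<..b} \<in> null_sets std_normal_distribution" by (auto simp: null_sets_def)
    then have "AE x in lborel. x \<in> {a<..b} \<longrightarrow> ennreal (std_normal_density x) = 0"
      by (subst (asm) null_sets_density_iff) auto
    moreover have "ennreal (std_normal_density x) \<noteq> 0" for x
      using normal_density_pos[of 1 0 x] by (simp add: ennreal_eq_0_iff)
    ultimately have "AE x in lborel. x \<notin> {a<..b}" by simp
    then have "emeasure lborel {a<..b} = 0"
      by (subst (asm) AE_iff_measurable[OF _ refl])
         (auto simp: greaterThanAtMost_def greaterThan_def atMost_def Int_def)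
    with ab show False by simp
  qed
  then have "0 < measure std_normal_distribution {a<..b}"
    by (simp add: zero_less_measure_iff emeasure_eq_measure)
  then show "cdf std_normal_distribution a < cdf std_normal_distribution b"
    using cdf_diff_eq[OF ab] by simp
qed

lemma cdf_std_normal_quantile:
  assumes "0 < \<nu>" "\<nu> < 1"
  shows "cdf std_normal_distribution (std_normal_quantile \<nu>) = \<nu>"
proof -
  interpret real_distribution std_normal_distribution by (rule real_dist_normal_dist)
  let ?F = "cdf std_normal_distribution"
  have "\<forall>\<^sub>F x in at_bot. ?F x < \<nu>" "\<forall>\<^sub>F x in at_top. ?F x > \<nu>"
    using order_tendstoD(2)[OF cdf_lim_at_bot] order_tendstoD(1)[OF cdf_lim_at_top_prob] assms by auto
  then obtain a b where ab: "?F a < \<nu>" "\<nu> < ?F b"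
    by (meson eventually_at_bot_linorder eventually_at_top_linorder order_refl)
  then have "a < b" using strict_mono_less[OF std_normal_cdf_strict_mono, of a b] by linarith
  then obtain q where q: "?F q = \<nu>"
    using IVT[of ?F a \<nu> b] ab std_normal_cdf_isCont by (auto simp: less_imp_le)
  have "\<exists>!q. ?F q = \<nu>"
    using q strict_mono_eq[OF std_normal_cdf_strict_mono] by auto
  from theI'[OF this] show ?thesis by (simp add: std_normal_quantile_def)
qed

lemma std_normal_quantile_less:
  assumes "0 < \<nu>" "\<nu> < \<nu>'" "\<nu>' < 1"
  shows "std_normal_quantile \<nu> < std_normal_quantile \<nu>'"
  using assms strict_mono_less[OF std_normal_cdf_strict_mono, of "std_normal_quantile \<nu>" "std_normal_quantile \<nu>'"]
  by (simp add: cdf_std_normal_quantile)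

section \<open>Asymptotics of most powerful tests\<close>

text \<open>
  The Neyman-Pearson inequality: \<open>(1\<^sub>S - \<Psi>) (L - k)\<close> is nonnegative everywhere, so a larger level
  of the threshold test forces a larger power. On the boundary \<open>L = k\<close> the set \<open>S\<close> may be chosen
  freely, and \<open>\<Psi>\<close> may randomize.
\<close>

lemma likelihood_threshold_test_dominates:
  fixes L \<Psi> :: "'a \<Rightarrow> real"
  assumes "prob_space P" and Q: "prob_space (density P L)"
    and L[measurable]: "L \<in> borel_measurable P" and L0: "\<And>y. 0 \<le> L y"
    and psi[measurable]: "\<Psi> \<in> borel_measurable P"
    and psi01: "\<And>y. y \<in> space P \<Longrightarrow> 0 \<le> \<Psi> y \<and> \<Psi> y \<le> 1"
    and S[measurable]: "S \<in> sets P"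
    and in_S: "\<And>y. y \<in> S \<Longrightarrow> k \<le> L y" and out_S: "\<And>y. y \<in> space P - S \<Longrightarrow> L y \<le> k" and "0 \<le> k"
    and size: "(\<integral>y. \<Psi> y \<partial>P) \<le> measure P S"
  shows "(\<integral>y. \<Psi> y \<partial>density P L) \<le> measure (density P L) S"
proof -
  interpret P: prob_space P by fact
  interpret Q: prob_space "density P L" by fact
  have "integrable P L"
    using L0 Q.emeasure_space_1
    by (intro integrableI_nonneg) (auto simp: emeasure_density)
  then have int_L: "integrable P (\<lambda>y. L y * f y)" if [measurable]: "f \<in> borel_measurable P"
      and "\<And>y. y \<in> space P \<Longrightarrow> \<bar>f y\<bar> \<le> 1" for f :: "'a \<Rightarrow> real"
  proof (rule Bochner_Integration.integrable_bound)
    show "AE y in P. norm (L y * f y) \<le> norm (L y)"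
      using that by (intro AE_I2) (auto simp: abs_mult L0 mult_left_le)
  qed simp
  have int_psi: "integrable P \<Psi>" 
    using psi01 by (intro P.integrable_const_bound[where B=1]) (auto intro!: AE_I2)
  have int_S: "integrable P (indicator S :: 'a \<Rightarrow> real)"
    by (intro integrable_real_indicator) (auto simp: P.emeasure_eq_measure)
  have i1: "integrable P (\<lambda>y. L y * \<Psi> y)" and i2: "integrable P (\<lambda>y. L y * indicator S y)"
    using psi01 by (auto intro!: int_L simp: indicator_def)
  have "0 \<le> (\<integral>y. (indicator S y - \<Psi> y) * (L y - k) \<partial>P)"
  proof (rule integral_nonneg_AE, rule AE_I2)
    fix y assume y: "y \<in> space P"
    show "0 \<le> (indicator S y - \<Psi> y) * (L y - k)"
      using in_S[of y] out_S[of y] y psi01[OF y]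
      by (cases "y \<in> S") (auto intro: mult_nonneg_nonneg mult_nonneg_nonpos)
  qed
  also have "\<dots> = (\<integral>y. L y * indicator S y - L y * \<Psi> y - k * (indicator S y - \<Psi> y) \<partial>P)"
    by (intro Bochner_Integration.integral_cong) (auto simp: algebra_simps)
  also have "\<dots> = (\<integral>y. L y * indicator S y \<partial>P) - (\<integral>y. L y * \<Psi> y \<partial>P)
      - k * (measure P S - (\<integral>y. \<Psi> y \<partial>P))"
    using i1 i2 int_psi int_S by simp
  also have "\<dots> \<le> (\<integral>y. L y * indicator S y \<partial>P) - (\<integral>y. L y * \<Psi> y \<partial>P)"
    using size \<open>0 \<le> k\<close> by simp
  also have "(\<integral>y. L y * indicator S y \<partial>P) = measure (density P L) S"
    using integral_density[of "indicator S :: 'a \<Rightarrow> real" P L] L0 by simp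
  also have "(\<integral>y. L y * \<Psi> y \<partial>P) = (\<integral>y. \<Psi> y \<partial>density P L)"
    using integral_density[of \<Psi> P L] L0 by simp
  finally show ?thesis by simp
qed

lemma char_linear_statistic:
  fixes M :: "'i \<Rightarrow> real measure"
  assumes "finite I" and M: "\<And>i. real_distribution (M i)"
  shows "char (distr (Pi\<^sub>M I M) borel (\<lambda>y. \<Sum>i\<in>I. a i * (y i - \<mu> i))) u =
    (\<Prod>i\<in>I. iexp (- (u * a i * \<mu> i)) * char (M i) (u * a i))"
proof -
  interpret real_distribution "M i" for i by (rule M)
  interpret product_sigma_finite M ..
  have [measurable_cong]: "sets (M i) = sets borel" for i by simp
  have "char (distr (Pi\<^sub>M I M) borel (\<lambda>y. \<Sum>i\<in>I. a i * (y i - \<mu> i))) u =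
      (\<integral>y. iexp (u * (\<Sum>i\<in>I. a i * (y i - \<mu> i))) \<partial>Pi\<^sub>M I M)"
    unfolding char_def by (subst integral_distr) auto
  also have "\<dots> = (\<integral>y. (\<Prod>i\<in>I. iexp (- (u * a i * \<mu> i)) * iexp (u * a i * y i)) \<partial>Pi\<^sub>M I M)"
    using \<open>finite I\<close>
    by (intro Bochner_Integration.integral_cong refl)
       (simp add: sum_distrib_left exp_sum[symmetric] exp_add[symmetric] algebra_simps)
  also have "\<dots> = (\<Prod>i\<in>I. \<integral>x. iexp (- (u * a i * \<mu> i)) * iexp (u * a i * x) \<partial>M i)"
    using \<open>finite I\<close> by (subst product_integral_prod) (auto intro!: integrable_iexp)
  also have "\<dots> = (\<Prod>i\<in>I. iexp (- (u * a i * \<mu> i)) * char (M i) (u * a i))"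
    by (simp add: char_def)
  finally show ?thesis .
qed

lemma PiM_density:
  fixes M :: "'i \<Rightarrow> 'a measure"
  assumes I: "finite I" and M: "\<And>i. sigma_finite_measure (M i)" and N: "\<And>i. sigma_finite_measure (N i)"
    and f: "\<And>i. i \<in> I \<Longrightarrow> f i \<in> borel_measurable (M i)"
    and NM: "\<And>i. i \<in> I \<Longrightarrow> N i = density (M i) (f i)"
  shows "Pi\<^sub>M I N = density (Pi\<^sub>M I M) (\<lambda>y. \<Prod>i\<in>I. f i (y i))"
proof -
  interpret sigma_finite_measure "M i" for i by (rule M)
  interpret M: product_sigma_finite M ..
  interpret N: product_sigma_finite N by (simp add: product_sigma_finite_def N)
  note f[measurable]
  have sets: "sets (Pi\<^sub>M I M) = sets (Pi\<^sub>M I N)"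
    by (rule sets_PiM_cong) (auto simp: NM)
  show ?thesis
  proof (rule N.PiM_eqI[OF I, symmetric])
    fix A assume "\<And>i. i \<in> I \<Longrightarrow> A i \<in> sets (N i)"
    then have A: "\<And>i. i \<in> I \<Longrightarrow> A i \<in> sets (M i)" by (simp add: NM)
    then have "Pi\<^sub>E I A \<in> sets (Pi\<^sub>M I M)" using I by (intro sets_PiM_I_finite) auto
    then have "emeasure (density (Pi\<^sub>M I M) (\<lambda>y. \<Prod>i\<in>I. f i (y i))) (Pi\<^sub>E I A) =
        (\<integral>\<^sup>+y. (\<Prod>i\<in>I. f i (y i)) * indicator (Pi\<^sub>E I A) y \<partial>Pi\<^sub>M I M)"
      using I by (subst emeasure_density) auto
    also have "\<dots> = (\<integral>\<^sup>+y. (\<Prod>i\<in>I. f i (y i) * indicator (A i) (y i)) \<partial>Pi\<^sub>M I M)"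
    proof (intro nn_integral_cong)
      fix y assume "y \<in> space (Pi\<^sub>M I M)"
      then have "y \<in> Pi\<^sub>E I A \<longleftrightarrow> (\<forall>i\<in>I. y i \<in> A i)"
        by (auto simp: space_PiM PiE_iff)
      then have "indicator (Pi\<^sub>E I A) y = (\<Prod>i\<in>I. indicator (A i) (y i) :: ennreal)"
        using I by (auto simp: indicator_def prod_zero_iff)
      then show "(\<Prod>i\<in>I. f i (y i)) * indicator (Pi\<^sub>E I A) y = (\<Prod>i\<in>I. f i (y i) * indicator (A i) (y i))"
        by (simp add: prod.distrib)
    qed
    also have "\<dots> = (\<Prod>i\<in>I. \<integral>\<^sup>+x. f i x * indicator (A i) x \<partial>M i)"
      using I A by (intro M.product_nn_integral_prod) auto
    also have "\<dots> = (\<Prod>i\<in>I. emeasure (N i) (A i))"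
      using A by (intro prod.cong refl) (simp add: NM emeasure_density)
    finally show "emeasure (density (Pi\<^sub>M I M) (\<lambda>y. \<Prod>i\<in>I. f i (y i))) (Pi\<^sub>E I A) = \<dots>" .
  qed (simp add: sets)
qed

text \<open>
  The weights are negated so that the test rejects for small values of the statistic \<open>V\<close>; the quantiles
  \<open>q\<^sub>\<alpha>\<close> and \<open>q\<^sub>1\<^sub>-\<^sub>\<beta>\<close> then appear directly as limits of thresholds.
  The centrings \<open>\<mu>0\<close> and \<open>\<mu>1\<close> are those for which the statistic is asymptotically standard normal
  under the respective law, so their weighted distance \<open>m\<close> is the shift of \<open>V\<close> between the two hypotheses.
  The level of the test \<open>V \<le> c\<close> converges to \<open>\<Phi> c\<close> and its power behaves like \<open>\<Phi> (c + m)\<close>.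
\<close>

theorem most_powerful_shift_limit:
  fixes M0 M1 :: "nat \<Rightarrow> nat \<Rightarrow> real measure" and n :: "nat \<Rightarrow> nat"
    and r c \<mu>0 \<mu>1 :: "nat \<Rightarrow> nat \<Rightarrow> real" and s :: "nat \<Rightarrow> real"
  assumes M0: "\<And>t i. real_distribution (M0 t i)" and M1: "\<And>t i. real_distribution (M1 t i)"
    and LR: "\<forall>\<^sub>F t in sequentially. \<forall>i\<in>{1..n t}.
      M1 t i = density (M0 t i) (\<lambda>y. ennreal (exp (r t i * y - c t i)))"
    and s: "\<forall>\<^sub>F t in sequentially. 0 < s t"
    and char0: "\<And>u. (\<lambda>t. char (distr (Pi\<^sub>M {1..n t} (M0 t)) borel
        (\<lambda>y. \<Sum>i\<in>{1..n t}. - (r t i / s t) * (y i - \<mu>0 t i))) u)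
      \<longlonglongrightarrow> exp (- (u\<^sup>2) / 2)"
    and char1: "\<And>u. (\<lambda>t. char (distr (Pi\<^sub>M {1..n t} (M1 t)) borel
        (\<lambda>y. \<Sum>i\<in>{1..n t}. - (r t i / s t) * (y i - \<mu>1 t i))) u)
      \<longlonglongrightarrow> exp (- (u\<^sup>2) / 2)"
    and \<alpha>: "0 < \<alpha>" "\<alpha> < 1" and \<beta>: "0 < \<beta>" "\<beta> < 1"
    and test: "\<forall>\<^sub>F t in sequentially. \<exists>\<Psi>.
      most_powerful_test (n t) (Pi\<^sub>M {1..n t} (M0 t)) (Pi\<^sub>M {1..n t} (M1 t)) \<alpha> \<Psi> \<and>
      (\<integral>y. \<Psi> y \<partial>Pi\<^sub>M {1..n t} (M0 t)) = \<alpha> \<and> (\<integral>y. \<Psi> y \<partial>Pi\<^sub>M {1..n t} (M1 t)) = 1 - \<beta>"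
  shows "(\<lambda>t. (\<Sum>i\<in>{1..n t}. r t i * (\<mu>1 t i - \<mu>0 t i)) / s t)
    \<longlonglongrightarrow> std_normal_quantile (1 - \<beta>) - std_normal_quantile \<alpha>"
proof -
  interpret M0: real_distribution "M0 t i" for t i by (rule M0)
  interpret M1: real_distribution "M1 t i" for t i by (rule M1)
  interpret N: real_distribution std_normal_distribution by (rule real_dist_normal_dist)
  define P0 where "P0 t = Pi\<^sub>M {1..n t} (M0 t)" for t
  define P1 where "P1 t = Pi\<^sub>M {1..n t} (M1 t)" for t
  define m where "m t = (\<Sum>i\<in>{1..n t}. r t i * (\<mu>1 t i - \<mu>0 t i)) / s t" for t
  define V where "V t y = (\<Sum>i\<in>{1..n t}. - (r t i / s t) * (y i - \<mu>0 t i))" for t y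
  define F0 where "F0 t = distr (P0 t) borel (V t)" for t
  define F1 where "F1 t = distr (P1 t) borel (\<lambda>y. V t y + m t)" for t
  define S where "S t c = {y \<in> space (P0 t). V t y \<le> c}" for t c
  let ?\<Phi> = "cdf std_normal_distribution"
  let ?a = "std_normal_quantile \<alpha>" and ?b = "std_normal_quantile (1 - \<beta>)"

  have sets0: "sets (P0 t) = sets (Pi\<^sub>M {1..n t} (\<lambda>_. borel))"
    and sets1: "sets (P1 t) = sets (Pi\<^sub>M {1..n t} (\<lambda>_. borel))" for t
    unfolding P0_def P1_def by (auto intro!: sets_PiM_cong)
  have space0: "space (P0 t) = space (Pi\<^sub>M {1..n t} (\<lambda>_. borel))"
    and space1: "space (P1 t) = space (P0 t)" for t
    using sets_eq_imp_space_eq[OF sets0] sets_eq_imp_space_eq[OF sets1] by simp_all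
  have V[measurable]: "V t \<in> borel_measurable (Pi\<^sub>M {1..n t} (\<lambda>_. borel))" for t
    unfolding V_def by measurable
  have V0[measurable]: "V t \<in> borel_measurable (P0 t)" and V1[measurable]: "V t \<in> borel_measurable (P1 t)" for t
    using V by (simp_all add: measurable_cong_sets[OF sets0 refl] measurable_cong_sets[OF sets1 refl])
  have P0: "prob_space (P0 t)" and P1: "prob_space (P1 t)" for t
    unfolding P0_def P1_def by (auto intro!: prob_space_PiM M0.prob_space_axioms M1.prob_space_axioms)
  have F0: "real_distribution (F0 t)" and F1: "real_distribution (F1 t)" for t
    unfolding F0_def F1_def
    by (auto intro!: prob_space.real_distribution_distr P0 P1 V0 V1 borel_measurable_add)
  have V_m: "V t y + m t = (\<Sum>i\<in>{1..n t}. - (r t i / s t) * (y i - \<mu>1 t i))" for t y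
    unfolding V_def m_def sum_divide_distrib sum.distrib[symmetric]
    by (intro sum.cong refl) (simp add: field_simps diff_divide_distrib add_divide_distrib)

  have "(\<lambda>t. char (F0 t) u) \<longlonglongrightarrow> char std_normal_distribution u"
    and "(\<lambda>t. char (F1 t) u) \<longlonglongrightarrow> char std_normal_distribution u" for u
    using char0[of u] char1[of u]
    unfolding F0_def F1_def P0_def P1_def V_m unfolding char_std_normal_distribution V_def[abs_def] .
  then have "weak_conv_m F0 std_normal_distribution" "weak_conv_m F1 std_normal_distribution"
    by (auto intro!: levy_continuity[OF F0] levy_continuity[OF F1] real_dist_normal_dist)
  then have cdf0: "(\<lambda>t. cdf (F0 t) x) \<longlonglongrightarrow> ?\<Phi> x" and cdf1: "(\<lambda>t. cdf (F1 t) x) \<longlonglongrightarrow> ?\<Phi> x" for x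
    by (auto simp: weak_conv_m_def weak_conv_def std_normal_cdf_isCont)

  have S_sets: "S t c \<in> sets (P0 t)" for t c
    unfolding S_def by measurable
  have size: "measure (P0 t) (S t c) = cdf (F0 t) c" for t c
    unfolding cdf_def F0_def S_def by (subst measure_distr) (auto intro!: arg_cong[where f="measure _"])
  have power: "measure (P1 t) (S t c) = cdf (F1 t) (c + m t)" for t c
    unfolding cdf_def F1_def S_def by (subst measure_distr) (auto simp: space1 intro!: arg_cong[where f="measure _"])

  \<comment> \<open>A threshold test of level above \<open>\<alpha>\<close> is at least as powerful as \<open>\<Psi>\<close>, so its power is at least \<open>1 - \<beta>\<close>.\<close>
  have lower: "\<forall>\<^sub>F t in sequentially. ?b - ?a - 2 * e < m t" if "0 < e" for e
  proof -
    have "\<forall>\<^sub>F t in sequentially. \<alpha> < cdf (F0 t) (?a + e)"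
      using cdf_std_normal_quantile[OF \<alpha>] strict_monoD[OF std_normal_cdf_strict_mono, of ?a "?a + e"] that
      by (intro order_tendstoD[OF cdf0]) simp
    moreover have "\<forall>\<^sub>F t in sequentially. cdf (F1 t) (?b - e) < 1 - \<beta>"
      using cdf_std_normal_quantile[of "1 - \<beta>"] \<beta>
        strict_monoD[OF std_normal_cdf_strict_mono, of "?b - e" ?b] that
      by (intro order_tendstoD[OF cdf1]) simp
    ultimately show ?thesis using LR s test
    proof eventually_elim
      case (elim t)
      then obtain \<Psi> where mp: "most_powerful_test (n t) (P0 t) (P1 t) \<alpha> \<Psi>"
        and lev: "(\<integral>y. \<Psi> y \<partial>P0 t) = \<alpha>" and pow: "(\<integral>y. \<Psi> y \<partial>P1 t) = 1 - \<beta>"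
        unfolding P0_def P1_def by blast
      define K where "K = (\<Sum>i\<in>{1..n t}. r t i * \<mu>0 t i - c t i)"
      define L where "L y = exp (K - s t * V t y)" for y
      \<comment> \<open>The likelihood ratio is a decreasing function of \<open>V\<close>.\<close>
      have "P1 t = density (P0 t) (\<lambda>y. \<Prod>i\<in>{1..n t}. ennreal (exp (r t i * y i - c t i)))"
        unfolding P0_def P1_def using elim(3)
        by (intro PiM_density M0.sigma_finite_measure_axioms M1.sigma_finite_measure_axioms) auto
      also have "\<dots> = density (P0 t) L"
      proof (intro arg_cong2[where f=density] refl ext)
        fix y :: "nat \<Rightarrow> real"
        have "(\<Sum>i\<in>{1..n t}. r t i * y i - c t i) = K - s t * V t y"
          unfolding K_def V_def sum_distrib_left sum_subtractf[symmetric] using elim(4)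
          by (intro sum.cong refl) (simp add: field_simps)
        then show "(\<Prod>i\<in>{1..n t}. ennreal (exp (r t i * y i - c t i))) = ennreal (L y)"
          by (simp add: L_def prod_ennreal exp_sum[symmetric])
      qed
      finally have dens: "P1 t = density (P0 t) L" .
      have "1 - \<beta> \<le> measure (P1 t) (S t (?a + e))"
        unfolding pow[symmetric] dens
      proof (rule likelihood_threshold_test_dominates[OF P0, where k="exp (K - s t * (?a + e))"])
        show "prob_space (density (P0 t) L)" using P1[of t] by (simp add: dens)
        show "L \<in> borel_measurable (P0 t)" unfolding L_def by measurable
        show "\<Psi> \<in> borel_measurable (P0 t)"
          using mp by (simp add: most_powerful_test_def randomized_test_def measurable_cong_sets[OF sets0 refl])
        show "\<And>y. y \<in> space (P0 t) \<Longrightarrow> 0 \<le> \<Psi> y \<and> \<Psi> y \<le> 1"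
          using mp by (simp add: most_powerful_test_def randomized_test_def space0)
        show "(\<integral>y. \<Psi> y \<partial>P0 t) \<le> measure (P0 t) (S t (?a + e))"
          using elim(1) by (simp add: lev size)
      qed (use elim(4) S_sets in \<open>auto simp: L_def S_def intro!: mult_left_mono\<close>)
      with elim(2) have "cdf (F1 t) (?b - e) < cdf (F1 t) (?a + e + m t)"
        by (simp add: power)
      then have "?b - e < ?a + e + m t"
        using finite_borel_measure.cdf_nondecreasing[of "F1 t" "?a + e + m t" "?b - e"] F1[of t]
        by (meson not_le real_distribution.finite_borel_measure_M)
      then show ?case by simp
    qed
  qed

  \<comment> \<open>A threshold test of level below \<open>\<alpha>\<close> competes with \<open>\<Psi>\<close>, so its power is at most \<open>1 - \<beta>\<close>.\<close>
  have upper: "\<forall>\<^sub>F t in sequentially. m t < ?b - ?a + 2 * e" if "0 < e" for e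
  proof -
    have "\<forall>\<^sub>F t in sequentially. cdf (F0 t) (?a - e) < \<alpha>"
      using cdf_std_normal_quantile[OF \<alpha>] strict_monoD[OF std_normal_cdf_strict_mono, of "?a - e" ?a] that
      by (intro order_tendstoD[OF cdf0]) simp
    moreover have "\<forall>\<^sub>F t in sequentially. 1 - \<beta> < cdf (F1 t) (?b + e)"
      using cdf_std_normal_quantile[of "1 - \<beta>"] \<beta>
        strict_monoD[OF std_normal_cdf_strict_mono, of ?b "?b + e"] that
      by (intro order_tendstoD[OF cdf1]) simp
    ultimately show ?thesis using test
    proof eventually_elim
      case (elim t)
      then obtain \<Psi> where mp: "most_powerful_test (n t) (P0 t) (P1 t) \<alpha> \<Psi>"
        and pow: "(\<integral>y. \<Psi> y \<partial>P1 t) = 1 - \<beta>"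
        unfolding P0_def P1_def by blast
      let ?T = "indicator (S t (?a - e)) :: _ \<Rightarrow> real"
      have "randomized_test (n t) ?T"
        using S_sets[of t "?a - e"] by (auto simp: randomized_test_def sets0 indicator_def)
      moreover have "(\<integral>y. ?T y \<partial>P0 t) \<le> \<alpha>"
        using elim(1) S_sets[of t "?a - e"] by (simp add: size)
      ultimately have "(\<integral>y. ?T y \<partial>P1 t) \<le> 1 - \<beta>"
        using mp pow by (auto simp: most_powerful_test_def)
      then have "measure (P1 t) (S t (?a - e)) \<le> 1 - \<beta>"
        using S_sets[of t "?a - e"] sets0 sets1 by simp
      with elim(2) have "cdf (F1 t) (?a - e + m t) < cdf (F1 t) (?b + e)"
        by (simp add: power)
      then have "?a - e + m t < ?b + e"
        using finite_borel_measure.cdf_nondecreasing[of "F1 t" "?b + e" "?a - e + m t"] F1[of t]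
        by (meson not_le real_distribution.finite_borel_measure_M)
      then show ?case by simp
    qed
  qed

  have "m \<longlonglongrightarrow> ?b - ?a"
  proof (rule tendstoI)
    fix e :: real assume "0 < e"
    then have "0 < e / 2" by simp
    from lower[OF this] upper[OF this]
    show "\<forall>\<^sub>F t in sequentially. dist (m t) (?b - ?a) < e"
      by eventually_elim (auto simp: dist_real_def abs_less_iff)
  qed
  then show ?thesis by (simp add: m_def[abs_def])
qed

section \<open>Gaussian and Poisson observations\<close>

abbreviation gaussian_law :: "real \<Rightarrow> real measure" where
  "gaussian_law \<mu> \<equiv> density lborel (normal_density \<mu> 1)"

lemma real_distribution_gaussian: "real_distribution (gaussian_law \<mu>)"
  using prob_space_normal_density[of 1 \<mu>]
  by (auto simp: real_distribution_def real_distribution_axioms_def)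

lemma gaussian_density:
  "gaussian_law \<nu> = density (gaussian_law \<mu>) (\<lambda>y. ennreal (exp ((\<nu> - \<mu>) * y - (\<nu>\<^sup>2 - \<mu>\<^sup>2) / 2)))"
proof -
  have "normal_density \<nu> 1 y = normal_density \<mu> 1 y * exp ((\<nu> - \<mu>) * y - (\<nu>\<^sup>2 - \<mu>\<^sup>2) / 2)" for y
    unfolding normal_density_def by (simp add: exp_add[symmetric] power2_eq_square field_simps)
  then show ?thesis
    by (subst density_density_eq) (auto simp: ennreal_mult' intro!: arg_cong2[where f=density])
qed

lemma char_gaussian: "char (gaussian_law \<mu>) v = iexp (v * \<mu>) * exp (- (v\<^sup>2) / 2)"
proof -
  have "char (gaussian_law \<mu>) v = (\<integral>x. normal_density \<mu> 1 x *\<^sub>R iexp (v * x) \<partial>lborel)"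
    unfolding char_def by (subst integral_density) auto
  also have "\<dots> = (\<integral>x. std_normal_density x *\<^sub>R iexp (v * (\<mu> + x)) \<partial>lborel)"
    by (subst lborel_integral_real_affine[where c=1 and t=\<mu>])
       (auto simp: normal_density_def)
  also have "\<dots> = (\<integral>x. iexp (v * \<mu>) * (std_normal_density x *\<^sub>R iexp (v * x)) \<partial>lborel)"
    by (intro Bochner_Integration.integral_cong refl) (simp add: exp_add[symmetric] algebra_simps)
  also have "\<dots> = iexp (v * \<mu>) * (\<integral>x. std_normal_density x *\<^sub>R iexp (v * x) \<partial>lborel)"
    by (rule integral_mult_right_zero)
  also have "(\<integral>x. std_normal_density x *\<^sub>R iexp (v * x) \<partial>lborel) = char std_normal_distribution v"
    unfolding char_def by (subst integral_density) auto
  finally show ?thesis by (simp add: char_std_normal_distribution)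
qed

lemma real_distribution_poisson: "real_distribution (poisson_law \<theta>)"
  unfolding poisson_law_def
  by (rule prob_space.real_distribution_distr) (auto intro: prob_space_measure_pmf)

lemma poisson_density:
  assumes "0 < \<theta>" "0 < \<theta>'"
  shows "poisson_law \<theta>' = density (poisson_law \<theta>) (\<lambda>y. ennreal (exp (ln (\<theta>' / \<theta>) * y - (\<theta>' - \<theta>))))"
proof -
  have "pmf (poisson_pmf \<theta>') k = pmf (poisson_pmf \<theta>) k * exp (ln (\<theta>' / \<theta>) * real k - (\<theta>' - \<theta>))" for k
  proof -
    have "exp (ln (\<theta>' / \<theta>) * real k) = (\<theta>' / \<theta>) ^ k"
      using assms exp_of_nat_mult[of k "ln (\<theta>' / \<theta>)"] by (simp add: mult.commute)
    then show ?thesis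
      using assms by (simp add: exp_diff exp_minus exp_add power_divide field_simps)
  qed
  then have "measure_pmf (poisson_pmf \<theta>') =
      density (poisson_pmf \<theta>) (\<lambda>k. ennreal (exp (ln (\<theta>' / \<theta>) * real k - (\<theta>' - \<theta>))))"
    unfolding measure_pmf_eq_density
    by (subst density_density_eq) (auto simp: ennreal_mult' intro!: arg_cong2[where f=density])
  then show ?thesis
    using assms by (simp add: poisson_law_def density_distr)
qed

text \<open>
  The series of the expectation is the exponential series at \<open>\<theta> e\<^sup>i\<^sup>v\<close>, scaled by \<open>e\<^sup>-\<^sup>\<theta>\<close>.
\<close>

lemma char_poisson:
  assumes "0 < \<theta>"
  shows "char (poisson_law \<theta>) v = exp (complex_of_real \<theta> * (iexp v - 1))"
proof -
  let ?z = "complex_of_real \<theta> * iexp v"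
  let ?f = "\<lambda>k. pmf (poisson_pmf \<theta>) k *\<^sub>R iexp (v * real k)"
  have f: "?f k = (?z ^ k /\<^sub>R fact k) * exp (- complex_of_real \<theta>)" for k
    using assms
    by (simp add: scaleR_conv_of_real power_mult_distrib exp_of_nat_mult[symmetric] exp_of_real field_simps
        flip: exp_of_real of_real_minus)
  have sums: "?f sums (exp ?z * exp (- complex_of_real \<theta>))"
    unfolding f by (intro sums_mult2 exp_converges)
  have "char (poisson_law \<theta>) v = (\<integral>k. iexp (v * real k) \<partial>measure_pmf (poisson_pmf \<theta>))"
    using assms unfolding char_def poisson_law_def by (subst integral_distr) auto
  also have "\<dots> = (\<integral>k. ?f k \<partial>count_space UNIV)"
    unfolding measure_pmf_eq_density by (subst integral_density) auto
  also have "\<dots> = exp ?z * exp (- complex_of_real \<theta>)"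
  proof -
    have "integrable (count_space UNIV) ?f"
      using assms integrable_pmf[of UNIV "poisson_pmf \<theta>"]
      by (rule_tac Bochner_Integration.integrable_bound[of _ "pmf (poisson_pmf \<theta>)"]) auto
    from sums_integral_count_space_nat[OF this] show ?thesis
      using sums sums_unique2 by blast
  qed
  also have "\<dots> = exp (complex_of_real \<theta> * (iexp v - 1))"
    by (simp add: exp_add[symmetric] algebra_simps)
  finally show ?thesis .
qed

text \<open>
  Both centred statistics are exactly normal with variance \<open>\<Sum> (\<nu>\<^sub>i - \<mu>\<^sub>i)\<^sup>2 / s\<^sup>2\<close>, and the shift between
  the hypotheses is this variance times \<open>s\<close>. Normalizing by any \<open>s\<close> that is asymptotic to the standard
  deviation, rather than by the standard deviation, lets an explicit rate be inserted for \<open>s\<close>.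
\<close>

theorem gaussian_resolution_limit:
  fixes \<mu> \<nu> :: "nat \<Rightarrow> nat \<Rightarrow> real" and s :: "nat \<Rightarrow> real"
  assumes s: "\<forall>\<^sub>F t in sequentially. 0 < s t"
    and var: "(\<lambda>t. (\<Sum>i\<in>{1..n t}. (\<nu> t i - \<mu> t i)\<^sup>2) / (s t)\<^sup>2) \<longlonglongrightarrow> 1"
    and \<alpha>: "0 < \<alpha>" "\<alpha> < 1" and \<beta>: "0 < \<beta>" "\<beta> < 1"
    and test: "\<forall>\<^sub>F t in sequentially. \<exists>\<Psi>.
      most_powerful_test (n t) (Pi\<^sub>M {1..n t} (\<lambda>i. gaussian_law (\<mu> t i)))
        (Pi\<^sub>M {1..n t} (\<lambda>i. gaussian_law (\<nu> t i))) \<alpha> \<Psi> \<and>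
      (\<integral>y. \<Psi> y \<partial>Pi\<^sub>M {1..n t} (\<lambda>i. gaussian_law (\<mu> t i))) = \<alpha> \<and>
      (\<integral>y. \<Psi> y \<partial>Pi\<^sub>M {1..n t} (\<lambda>i. gaussian_law (\<nu> t i))) = 1 - \<beta>"
  shows "s \<longlonglongrightarrow> std_normal_quantile (1 - \<beta>) - std_normal_quantile \<alpha>"
proof -
  define r where "r t i = \<nu> t i - \<mu> t i" for t i
  have char_lim: "(\<lambda>t. char (distr (Pi\<^sub>M {1..n t} (\<lambda>i. gaussian_law (\<kappa> t i))) borel
      (\<lambda>y. \<Sum>i\<in>{1..n t}. - (r t i / s t) * (y i - \<kappa> t i))) u) \<longlonglongrightarrow> exp (- (u\<^sup>2) / 2)" for \<kappa> u
  proof -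
    have "char (distr (Pi\<^sub>M {1..n t} (\<lambda>i. gaussian_law (\<kappa> t i))) borel
        (\<lambda>y. \<Sum>i\<in>{1..n t}. - (r t i / s t) * (y i - \<kappa> t i))) u
      = exp (- (u\<^sup>2 * ((\<Sum>i\<in>{1..n t}. (r t i)\<^sup>2) / (s t)\<^sup>2)) / 2)" for t
    proof -
      have "char (distr (Pi\<^sub>M {1..n t} (\<lambda>i. gaussian_law (\<kappa> t i))) borel
          (\<lambda>y. \<Sum>i\<in>{1..n t}. - (r t i / s t) * (y i - \<kappa> t i))) u
        = (\<Prod>i\<in>{1..n t}. complex_of_real (exp (- (u\<^sup>2 * ((r t i)\<^sup>2 / (s t)\<^sup>2)) / 2)))"
        by (subst char_linear_statistic)
           (auto simp: real_distribution_gaussian char_gaussian exp_add[symmetric] power_mult_distrib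
             power_divide exp_of_real[symmetric] intro!: prod.cong)
      also have "\<dots> = complex_of_real (exp (\<Sum>i\<in>{1..n t}. - (u\<^sup>2 * ((r t i)\<^sup>2 / (s t)\<^sup>2)) / 2))"
        by (simp add: exp_sum)
      finally show ?thesis
        by (simp add: sum_divide_distrib sum_distrib_left sum_negf)
    qed
    then show ?thesis
      using tendsto_of_real[OF tendsto_exp[OF tendsto_divide[OF tendsto_minus[OF
        tendsto_mult[OF tendsto_const[of "u\<^sup>2"] var]] tendsto_const[of 2]]], where 'a=complex]
      by (simp add: r_def)
  qed
  have "(\<lambda>t. (\<Sum>i\<in>{1..n t}. r t i * (\<nu> t i - \<mu> t i)) / s t)
      \<longlonglongrightarrow> std_normal_quantile (1 - \<beta>) - std_normal_quantile \<alpha>"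
  proof (rule most_powerful_shift_limit[OF _ _ _ s _ _ \<alpha> \<beta> test])
    show "\<forall>\<^sub>F t in sequentially. \<forall>i\<in>{1..n t}. gaussian_law (\<nu> t i) =
        density (gaussian_law (\<mu> t i)) (\<lambda>y. ennreal (exp (r t i * y - ((\<nu> t i)\<^sup>2 - (\<mu> t i)\<^sup>2) / 2)))"
      unfolding r_def using gaussian_density by auto
  qed (rule real_distribution_gaussian char_lim)+
  then have "(\<lambda>t. ((\<Sum>i\<in>{1..n t}. (r t i)\<^sup>2) / s t) / ((\<Sum>i\<in>{1..n t}. (r t i)\<^sup>2) / (s t)\<^sup>2))
      \<longlonglongrightarrow> (std_normal_quantile (1 - \<beta>) - std_normal_quantile \<alpha>) / 1"
    using var by (intro tendsto_divide) (simp_all add: r_def power2_eq_square)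
  moreover have "\<forall>\<^sub>F t in sequentially.
      ((\<Sum>i\<in>{1..n t}. (r t i)\<^sup>2) / s t) / ((\<Sum>i\<in>{1..n t}. (r t i)\<^sup>2) / (s t)\<^sup>2) = s t"
    using s order_tendstoD(1)[OF var, of 0, simplified]
    by eventually_elim (auto simp: r_def power2_eq_square field_simps)
  ultimately show ?thesis
    using tendsto_cong by fastforce
qed

text \<open>
  A central limit theorem for weighted Poisson variables. The exponent of the characteristic function
  is \<open>\<Sum> \<theta>\<^sub>i (e\<^sup>i\<^sup>u\<^sup>a - 1 - i u a)\<close> with \<open>a = a\<^sub>i\<close>; its quadratic part converges to \<open>- u\<^sup>2 / 2\<close>, and the remainder is
  at most \<open>\<bar>u\<bar>\<^sup>3 / 6\<close> times the variance times the largest weight. The individual rates \<open>\<theta>\<^sub>i\<close> may tend to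
  zero, as they do when there are many more bins than observed events.
\<close>

lemma char_poisson_linear_statistic_tendsto:
  fixes a \<theta> :: "nat \<Rightarrow> nat \<Rightarrow> real" and B :: "nat \<Rightarrow> real"
  assumes pos: "\<forall>\<^sub>F t in sequentially. \<forall>i\<in>{1..n t}. 0 < \<theta> t i"
    and small: "\<forall>\<^sub>F t in sequentially. \<forall>i\<in>{1..n t}. \<bar>a t i\<bar> \<le> B t" and B: "B \<longlonglongrightarrow> 0"
    and var: "(\<lambda>t. \<Sum>i\<in>{1..n t}. (a t i)\<^sup>2 * \<theta> t i) \<longlonglongrightarrow> 1"
  shows "(\<lambda>t. char (distr (Pi\<^sub>M {1..n t} (\<lambda>i. poisson_law (\<theta> t i))) borel
      (\<lambda>y. \<Sum>i\<in>{1..n t}. a t i * (y i - \<theta> t i))) u) \<longlonglongrightarrow> exp (- (u\<^sup>2) / 2)"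
proof -
  define v where "v t = (\<Sum>i\<in>{1..n t}. (a t i)\<^sup>2 * \<theta> t i)" for t
  define R where "R x = iexp x - 1 - \<i> * complex_of_real x + complex_of_real (x\<^sup>2 / 2)" for x
  define E where "E t = (\<Sum>i\<in>{1..n t}. complex_of_real (\<theta> t i) * R (u * a t i))" for t
  have R: "cmod (R x) \<le> \<bar>x\<bar> ^ 3 / 6" for x
    using iexp_approx1[of x 2] by (simp add: R_def numeral_eq_Suc power_mult_distrib algebra_simps)
  have "\<forall>\<^sub>F t in sequentially. norm (E t) \<le> \<bar>u\<bar> ^ 3 / 6 * (B t * v t)"
    using pos small
  proof eventually_elim
    case (elim t)
    have "norm (E t) \<le> (\<Sum>i\<in>{1..n t}. \<bar>u\<bar> ^ 3 / 6 * (B t * ((a t i)\<^sup>2 * \<theta> t i)))"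
      unfolding E_def
    proof (rule sum_norm_le)
      fix i assume i: "i \<in> {1..n t}"
      have "norm (complex_of_real (\<theta> t i) * R (u * a t i)) \<le> \<theta> t i * (\<bar>u * a t i\<bar> ^ 3 / 6)"
        unfolding norm_mult using R[of "u * a t i"] elim(1) i by (intro mult_mono) (auto simp: less_imp_le)
      also have "\<dots> = \<bar>u\<bar> ^ 3 / 6 * (\<bar>a t i\<bar> * ((a t i)\<^sup>2 * \<theta> t i))"
      proof -
        have "\<bar>a t i\<bar> ^ 3 = \<bar>a t i\<bar> * (a t i)\<^sup>2"
          using power_Suc[of "\<bar>a t i\<bar>" 2] by (simp add: numeral_eq_Suc)
        then show ?thesis by (simp add: abs_mult power_mult_distrib)
      qed
      also have "\<dots> \<le> \<bar>u\<bar> ^ 3 / 6 * (B t * ((a t i)\<^sup>2 * \<theta> t i))"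
        using elim i by (intro mult_left_mono mult_right_mono) (auto simp: less_imp_le)
      finally show "norm (complex_of_real (\<theta> t i) * R (u * a t i)) \<le> \<dots>" .
    qed
    then show ?case by (simp add: v_def sum_distrib_left)
  qed
  moreover have "(\<lambda>t. \<bar>u\<bar> ^ 3 / 6 * (B t * v t)) \<longlonglongrightarrow> 0"
    using tendsto_mult[OF tendsto_const[of "\<bar>u\<bar> ^ 3 / 6"] tendsto_mult[OF B var]] by (simp add: v_def)
  ultimately have E: "E \<longlonglongrightarrow> 0"
    by (rule Lim_null_comparison)
  have "(\<lambda>t. exp (E t - complex_of_real (u\<^sup>2 / 2 * v t))) \<longlonglongrightarrow> exp (0 - complex_of_real (u\<^sup>2 / 2 * 1))"
    unfolding v_def by (intro tendsto_intros E var)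
  moreover have "\<forall>\<^sub>F t in sequentially. exp (E t - complex_of_real (u\<^sup>2 / 2 * v t)) =
      char (distr (Pi\<^sub>M {1..n t} (\<lambda>i. poisson_law (\<theta> t i))) borel
        (\<lambda>y. \<Sum>i\<in>{1..n t}. a t i * (y i - \<theta> t i))) u"
    using pos
  proof eventually_elim
    case (elim t)
    have "E t - complex_of_real (u\<^sup>2 / 2 * v t) = (\<Sum>i\<in>{1..n t}.
        complex_of_real (\<theta> t i) * (iexp (u * a t i) - 1) - \<i> * complex_of_real (u * a t i * \<theta> t i))"
      unfolding E_def v_def R_def sum_distrib_left of_real_sum sum_subtractf[symmetric]
      by (intro sum.cong refl) (simp add: field_simps power2_eq_square)
    then have "exp (E t - complex_of_real (u\<^sup>2 / 2 * v t)) = (\<Prod>i\<in>{1..n t}.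
        iexp (- (u * a t i * \<theta> t i)) * exp (complex_of_real (\<theta> t i) * (iexp (u * a t i) - 1)))"
      by (simp only: exp_sum finite_atLeastAtMost) (simp add: exp_add[symmetric] algebra_simps)
    also have "\<dots> = char (distr (Pi\<^sub>M {1..n t} (\<lambda>i. poisson_law (\<theta> t i))) borel
        (\<lambda>y. \<Sum>i\<in>{1..n t}. a t i * (y i - \<theta> t i))) u"
      using elim
      by (subst char_linear_statistic) (auto simp: real_distribution_poisson char_poisson intro!: prod.cong)
    finally show ?case .
  qed
  ultimately show ?thesis
    by (simp add: tendsto_cong exp_of_real[symmetric])
qed

text \<open>
  The variance conditions under both hypotheses and the condition on the shift say that \<open>s\<close> is
  asymptotic to the standard deviation of the log-likelihood ratio. For Poisson laws the three sums
  differ, and agree only to leading order when the rates of the two hypotheses are close.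
\<close>

theorem poisson_resolution_limit:
  fixes \<theta> \<theta>' :: "nat \<Rightarrow> nat \<Rightarrow> real" and s B :: "nat \<Rightarrow> real"
  defines "r \<equiv> \<lambda>t i. ln (\<theta>' t i / \<theta> t i)"
  assumes s: "\<forall>\<^sub>F t in sequentially. 0 < s t"
    and pos: "\<forall>\<^sub>F t in sequentially. \<forall>i\<in>{1..n t}. 0 < \<theta> t i \<and> 0 < \<theta>' t i"
    and small: "\<forall>\<^sub>F t in sequentially. \<forall>i\<in>{1..n t}. \<bar>r t i / s t\<bar> \<le> B t" and B: "B \<longlonglongrightarrow> 0"
    and var0: "(\<lambda>t. (\<Sum>i\<in>{1..n t}. (r t i)\<^sup>2 * \<theta> t i) / (s t)\<^sup>2) \<longlonglongrightarrow> 1"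
    and var1: "(\<lambda>t. (\<Sum>i\<in>{1..n t}. (r t i)\<^sup>2 * \<theta>' t i) / (s t)\<^sup>2) \<longlonglongrightarrow> 1"
    and shift: "(\<lambda>t. (\<Sum>i\<in>{1..n t}. r t i * (\<theta>' t i - \<theta> t i)) / (s t)\<^sup>2) \<longlonglongrightarrow> 1"
    and \<alpha>: "0 < \<alpha>" "\<alpha> < 1" and \<beta>: "0 < \<beta>" "\<beta> < 1"
    and test: "\<forall>\<^sub>F t in sequentially. \<exists>\<Psi>.
      most_powerful_test (n t) (Pi\<^sub>M {1..n t} (\<lambda>i. poisson_law (\<theta> t i)))
        (Pi\<^sub>M {1..n t} (\<lambda>i. poisson_law (\<theta>' t i))) \<alpha> \<Psi> \<and>
      (\<integral>y. \<Psi> y \<partial>Pi\<^sub>M {1..n t} (\<lambda>i. poisson_law (\<theta> t i))) = \<alpha> \<and>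
      (\<integral>y. \<Psi> y \<partial>Pi\<^sub>M {1..n t} (\<lambda>i. poisson_law (\<theta>' t i))) = 1 - \<beta>"
  shows "s \<longlonglongrightarrow> std_normal_quantile (1 - \<beta>) - std_normal_quantile \<alpha>"
proof -
  have char_lim: "(\<lambda>t. char (distr (Pi\<^sub>M {1..n t} (\<lambda>i. poisson_law (\<kappa> t i))) borel
      (\<lambda>y. \<Sum>i\<in>{1..n t}. - (r t i / s t) * (y i - \<kappa> t i))) u) \<longlonglongrightarrow> exp (- (u\<^sup>2) / 2)"
    if "\<forall>\<^sub>F t in sequentially. \<forall>i\<in>{1..n t}. 0 < \<kappa> t i"
      and "(\<lambda>t. (\<Sum>i\<in>{1..n t}. (r t i)\<^sup>2 * \<kappa> t i) / (s t)\<^sup>2) \<longlonglongrightarrow> 1" for \<kappa> u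
    using that small
    by (intro char_poisson_linear_statistic_tendsto[OF _ _ B])
       (auto simp: sum_divide_distrib power_divide)
  have "(\<lambda>t. (\<Sum>i\<in>{1..n t}. r t i * (\<theta>' t i - \<theta> t i)) / s t)
      \<longlonglongrightarrow> std_normal_quantile (1 - \<beta>) - std_normal_quantile \<alpha>"
  proof (rule most_powerful_shift_limit[OF _ _ _ s _ _ \<alpha> \<beta> test])
    show "\<forall>\<^sub>F t in sequentially. \<forall>i\<in>{1..n t}. poisson_law (\<theta>' t i) =
        density (poisson_law (\<theta> t i)) (\<lambda>y. ennreal (exp (r t i * y - (\<theta>' t i - \<theta> t i))))"
      using pos unfolding r_def by eventually_elim (auto intro!: poisson_density)
    show "\<And>u. (\<lambda>t. char (distr (Pi\<^sub>M {1..n t} (\<lambda>i. poisson_law (\<theta> t i))) borel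
      (\<lambda>y. \<Sum>i\<in>{1..n t}. - (r t i / s t) * (y i - \<theta> t i))) u) \<longlonglongrightarrow> exp (- (u\<^sup>2) / 2)"
      using pos by (intro char_lim var0) (auto elim: eventually_mono)
    show "\<And>u. (\<lambda>t. char (distr (Pi\<^sub>M {1..n t} (\<lambda>i. poisson_law (\<theta>' t i))) borel
      (\<lambda>y. \<Sum>i\<in>{1..n t}. - (r t i / s t) * (y i - \<theta>' t i))) u) \<longlonglongrightarrow> exp (- (u\<^sup>2) / 2)"
      using pos by (intro char_lim var1) (auto elim: eventually_mono)
  qed (rule real_distribution_poisson)+
  from tendsto_divide[OF this shift]
  have "(\<lambda>t. ((\<Sum>i\<in>{1..n t}. r t i * (\<theta>' t i - \<theta> t i)) / s t) /
        ((\<Sum>i\<in>{1..n t}. r t i * (\<theta>' t i - \<theta> t i)) / (s t)\<^sup>2))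
      \<longlonglongrightarrow> std_normal_quantile (1 - \<beta>) - std_normal_quantile \<alpha>"
    by simp
  moreover have "\<forall>\<^sub>F t in sequentially.
      ((\<Sum>i\<in>{1..n t}. r t i * (\<theta>' t i - \<theta> t i)) / s t) /
      ((\<Sum>i\<in>{1..n t}. r t i * (\<theta>' t i - \<theta> t i)) / (s t)\<^sup>2) = s t"
    using s order_tendstoD(1)[OF shift, of 0, simplified]
    by eventually_elim (auto simp: power2_eq_square)
  ultimately show ?thesis
    using tendsto_cong by fastforce
qed

section \<open>Bin averages and Riemann sums\<close>

text \<open>
  Sequences indexed by bins are read as step functions on \<open>{0<..1}\<close> through this index, so that
  uniformity over all bins becomes uniform convergence of functions. The point \<open>0\<close> is left out because
  its ceiling would give the index \<open>0\<close>.
\<close>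

definition bin_index :: "nat \<Rightarrow> real \<Rightarrow> nat" where
  "bin_index n x = nat \<lceil>real n * x\<rceil>"

lemma bin_index:
  assumes "1 \<le> n" "x \<in> {0<..1}"
  shows "bin_index n x \<in> {1..n}" and "x \<in> bin n (bin_index n x)"
proof -
  have "0 < real n * x" "real n * x \<le> real n" using assms by (auto simp: mult_left_le)
  then have c: "1 \<le> \<lceil>real n * x\<rceil>" "\<lceil>real n * x\<rceil> \<le> int n"
    by (auto simp: ceiling_le_iff less_ceiling_iff one_le_ceiling)
  then have "1 \<le> nat \<lceil>real n * x\<rceil>" "nat \<lceil>real n * x\<rceil> \<le> n" by arith+
  then show "bin_index n x \<in> {1..n}" by (simp add: bin_index_def)
  have "real (bin_index n x) = of_int \<lceil>real n * x\<rceil>" using c by (simp add: bin_index_def)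
  then have "real (bin_index n x) - 1 \<le> real n * x" "real n * x \<le> real (bin_index n x)"
    using ceiling_correct[of "real n * x"] by linarith+
  then show "x \<in> bin n (bin_index n x)"
    using assms by (auto simp: bin_def field_simps)
qed

lemma bin_index_unique:
  assumes "1 \<le> n" "i \<in> {1..n}" "x \<in> bin n i" "x \<noteq> (real i - 1) / real n"
  shows "bin_index n x = i" and "x \<in> {0<..1}"
proof -
  have "real i - 1 < real n * x" "real n * x \<le> real i" "0 \<le> real i - 1" "real i \<le> real n"
    using assms by (auto simp: bin_def field_simps)
  then have "\<lceil>real n * x\<rceil> = int i" by (simp add: ceiling_eq_iff)
  then show "bin_index n x = i" by (simp add: bin_index_def)
  have "0 < real n * x" "real n * x \<le> real n"
    using \<open>real i - 1 < real n * x\<close> \<open>real n * x \<le> real i\<close> \<open>0 \<le> real i - 1\<close> \<open>real i \<le> real n\<close>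
    by linarith+
  then show "x \<in> {0<..1}"
    using assms(1) by (auto simp: zero_less_mult_iff)
qed

lemma bin_subset:
  assumes "i \<in> {1..n}" shows "bin n i \<subseteq> {0..1}"
  using assms by (auto simp: bin_def field_simps)

text \<open>
  The left endpoint is exempt because it carries the index of the preceding bin, so nothing is known
  about a step function there.
\<close>

lemma integral_bin_approx:
  fixes f :: "real \<Rightarrow> real"
  assumes "1 \<le> n" "i \<in> {1..n}" and f: "f integrable_on bin n i"
    and close: "\<And>y. y \<in> bin n i \<Longrightarrow> y \<noteq> (real i - 1) / real n \<Longrightarrow> \<bar>f y - c\<bar> \<le> e" and "0 \<le> e"
  shows "\<bar>integral (bin n i) f - c / real n\<bar> \<le> e / real n"
proof -
  have width: "real i / real n - (real i - 1) / real n = 1 / real n"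
    by (simp add: diff_divide_distrib)
  have le: "(real i - 1) / real n \<le> real i / real n" by (simp add: divide_right_mono)
  have "((\<lambda>y. c) has_integral c / real n) (bin n i)"
    using has_integral_const_real[of c "(real i - 1) / real n" "real i / real n"] le width
    by (simp add: bin_def)
  from has_integral_diff[OF integrable_integral[OF f] this]
  have "((\<lambda>y. f y - c) has_integral (integral (bin n i) f - c / real n)) {(real i - 1) / real n..real i / real n}"
    by (simp add: bin_def)
  from has_integral_bound_spike_finite[OF \<open>0 \<le> e\<close>, of "{(real i - 1) / real n}", unfolded box_real, OF _ this]
  show ?thesis using close le width by (auto simp: bin_def)
qed

lemma integral_sum_bins:
  fixes f :: "real \<Rightarrow> real"
  assumes "1 \<le> n" and f: "f integrable_on {0..1}"
  shows "integral {0..1} f = (\<Sum>i\<in>{1..n}. integral (bin n i) f)"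
proof -
  have "integral {0..real k / real n} f = (\<Sum>i\<in>{1..k}. integral (bin n i) f)" if "k \<le> n" for k
    using that
  proof (induction k)
    case (Suc k)
    have "f integrable_on {0..real (Suc k) / real n}"
      by (rule integrable_on_subinterval[OF f]) (use Suc.prems in \<open>auto simp: field_simps\<close>)
    then have "integral {0..real k / real n} f + integral {real k / real n..real (Suc k) / real n} f
        = integral {0..real (Suc k) / real n} f"
      by (intro Henstock_Kurzweil_Integration.integral_combine) (auto simp: divide_right_mono)
    then show ?case using Suc by (simp add: bin_def)
  qed simp
  from this[of n] show ?thesis using assms(1) by simp
qed

text \<open>
  The values on the bins need not come from \<open>Q\<close>: uniform closeness to \<open>Q\<close> suffices, since both sides
  split over the bins with an error of at most \<open>\<epsilon> / n\<close> in each.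
\<close>

lemma step_riemann_sum_tendsto:
  fixes q :: "nat \<Rightarrow> nat \<Rightarrow> real" and Q :: "real \<Rightarrow> real"
  assumes n: "filterlim n at_top sequentially" and Q: "continuous_on {0..1} Q"
    and lim: "uniform_limit {0<..1} (\<lambda>t x. q t (bin_index (n t) x)) Q sequentially"
  shows "(\<lambda>t. (\<Sum>i\<in>{1..n t}. q t i) / real (n t)) \<longlonglongrightarrow> integral {0..1} Q"
proof (rule tendstoI)
  fix e :: real assume "0 < e"
  then have "0 < e / 2" by simp
  have "\<forall>\<^sub>F t in sequentially. 1 \<le> n t" using n by (auto simp: filterlim_at_top)
  with uniform_limitD[OF lim \<open>0 < e / 2\<close>]
  show "\<forall>\<^sub>F t in sequentially. dist ((\<Sum>i\<in>{1..n t}. q t i) / real (n t)) (integral {0..1} Q) < e"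
  proof eventually_elim
    case (elim t)
    have Qi: "Q integrable_on {0..1}" by (rule integrable_continuous_real[OF Q])
    have "\<bar>integral (bin (n t) i) Q - q t i / real (n t)\<bar> \<le> (e / 2) / real (n t)" if i: "i \<in> {1..n t}" for i
    proof (rule integral_bin_approx[OF elim(2) i])
      show "Q integrable_on bin (n t) i"
        using bin_subset[OF i] unfolding bin_def by (rule integrable_on_subinterval[OF Qi])
      fix y assume y: "y \<in> bin (n t) i" "y \<noteq> (real i - 1) / real (n t)"
      with elim(1) bin_index_unique[OF elim(2) i y] show "\<bar>Q y - q t i\<bar> \<le> e / 2"
        by (force simp: dist_real_def abs_minus_commute)
    qed (use \<open>0 < e\<close> in simp)
    then have "\<bar>\<Sum>i\<in>{1..n t}. integral (bin (n t) i) Q - q t i / real (n t)\<bar> \<le> (\<Sum>i\<in>{1..n t}. (e / 2) / real (n t))"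
      by (intro order_trans[OF sum_abs sum_mono])
    also have "\<dots> = e / 2" using elim(2) by simp
    finally show ?case
      using \<open>0 < e\<close> integral_sum_bins[OF elim(2) Qi]
      by (simp add: dist_real_def sum_subtractf sum_divide_distrib abs_minus_commute)
  qed
qed

lemma bin_average_uniform_limit:
  fixes g :: "nat \<Rightarrow> real \<Rightarrow> real" and G :: "real \<Rightarrow> real"
  assumes n: "filterlim n at_top sequentially" and G: "continuous_on {0..1} G"
    and g: "\<forall>\<^sub>F t in sequentially. continuous_on {0..1} (g t)"
    and lim: "uniform_limit {0..1} g G sequentially"
  shows "uniform_limit {0<..1} (\<lambda>t x. real (n t) * integral (bin (n t) (bin_index (n t) x)) (g t)) G sequentially"
proof (rule uniform_limitI)
  fix e :: real assume "0 < e"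
  then have "0 < e / 3" by simp
  have "uniformly_continuous_on {0..1} G"
    using G by (intro compact_uniformly_continuous) auto
  then obtain \<delta> where "0 < \<delta>" and \<delta>: "\<And>x y. x \<in> {0..1} \<Longrightarrow> y \<in> {0..1} \<Longrightarrow> dist y x < \<delta> \<Longrightarrow> dist (G y) (G x) < e / 3"
    unfolding uniformly_continuous_on_def using \<open>0 < e / 3\<close> by meson
  have "\<forall>\<^sub>F t in sequentially. nat \<lceil>2 / \<delta>\<rceil> + 1 \<le> n t" using n by (auto simp: filterlim_at_top)
  with uniform_limitD[OF lim \<open>0 < e / 3\<close>] g
  show "\<forall>\<^sub>F t in sequentially. \<forall>x\<in>{0<..1}.
      dist (real (n t) * integral (bin (n t) (bin_index (n t) x)) (g t)) (G x) < e"
  proof eventually_elim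
    case (elim t)
    have n1: "1 \<le> n t" and "2 / \<delta> < real (n t)" using elim(3) by linarith+
    then have fine: "1 / real (n t) < \<delta>" using \<open>0 < \<delta>\<close> by (simp add: field_simps)
    show ?case
    proof
      fix x :: real assume x: "x \<in> {0<..1}"
      define i where "i = bin_index (n t) x"
      have i: "i \<in> {1..n t}" and xi: "x \<in> bin (n t) i"
        using bin_index[OF n1 x] by (simp_all add: i_def)
      have "\<bar>integral (bin (n t) i) (g t) - G x / real (n t)\<bar> \<le> (2 * (e / 3)) / real (n t)"
      proof (rule integral_bin_approx[OF n1 i])
        show "g t integrable_on bin (n t) i"
          unfolding bin_def
          by (rule integrable_continuous_real, rule continuous_on_subset[OF elim(2)])
            (use bin_subset[OF i] in \<open>simp add: bin_def\<close>)
        fix y assume y: "y \<in> bin (n t) i"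
        have "\<bar>y - x\<bar> \<le> 1 / real (n t)"
          using y xi n1 by (auto simp: bin_def field_simps abs_le_iff)
        then have "dist (G y) (G x) < e / 3"
          using \<delta>[of x y] y x fine bin_subset[OF i] by (auto simp: dist_real_def)
        moreover have "dist (g t y) (G y) < e / 3" using elim(1) y bin_subset[OF i] by auto
        ultimately show "\<bar>g t y - G x\<bar> \<le> 2 * (e / 3)" unfolding dist_real_def by linarith
      qed (use \<open>0 < e\<close> in simp)
      then have "real (n t) * \<bar>integral (bin (n t) i) (g t) - G x / real (n t)\<bar> \<le> 2 * (e / 3)"
        using n1 by (simp add: field_simps)
      moreover have "real (n t) * \<bar>integral (bin (n t) i) (g t) - G x / real (n t)\<bar>
          = \<bar>real (n t) * integral (bin (n t) i) (g t) - G x\<bar>"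
      proof -
        have "real (n t) * (integral (bin (n t) i) (g t) - G x / real (n t))
            = real (n t) * integral (bin (n t) i) (g t) - G x"
          using n1 by (simp add: right_diff_distrib)
        then show ?thesis by (metis abs_mult abs_of_nat)
      qed
      ultimately show "dist (real (n t) * integral (bin (n t) (bin_index (n t) x)) (g t)) (G x) < e"
        using \<open>0 < e\<close> by (simp add: dist_real_def i_def)
    qed
  qed
qed

text \<open>
  A compact set has a compact neighbourhood inside every open set that contains it, and a uniformly convergent
  family enters this neighbourhood.
\<close>

lemma uniform_limit_eventually_in_compact:
  fixes q :: "'t \<Rightarrow> 'x \<Rightarrow> 'a::heine_borel"
  assumes lim: "uniform_limit X q Q F" and K: "compact K" "Q ` X \<subseteq> K" "K \<subseteq> U" and U: "open U"
  obtains N where "compact N" "N \<subseteq> U" "\<forall>\<^sub>F t in F. \<forall>x\<in>X. q t x \<in> N"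
proof (cases "X = {}")
  case True
  then show ?thesis using that[of "{}"] by simp
next
  case False
  then have "K \<noteq> {}" using K by auto
  obtain \<delta> where \<delta>: "0 < \<delta>" "{x. infdist x K \<le> \<delta>} \<subseteq> U"
    using compact_in_open_separated[OF \<open>K \<noteq> {}\<close> K(1) U K(3)] by blast
  have "\<forall>\<^sub>F t in F. \<forall>x\<in>X. q t x \<in> {x. infdist x K \<le> \<delta>}"
    using uniform_limitD[OF lim \<delta>(1)]
  proof eventually_elim
    case (elim t)
    show ?case
    proof
      fix x assume "x \<in> X"
      then show "q t x \<in> {x. infdist x K \<le> \<delta>}"
        using infdist_le2[of "Q x" K "q t x" \<delta>] elim K(2) by (auto intro: less_imp_le)
    qed
  qed
  then show ?thesis
    using that[OF compact_infdist_le[OF \<open>K \<noteq> {}\<close> K(1) \<delta>(1)] \<delta>(2)] by blast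
qed

lemma uniform_limit_compose_compact_range:
  fixes q :: "'t \<Rightarrow> 'x \<Rightarrow> 'a::heine_borel" and \<Phi> :: "'a \<Rightarrow> 'b::metric_space"
  assumes lim: "uniform_limit X q Q F" and K: "compact K" "Q ` X \<subseteq> K" "K \<subseteq> U"
    and U: "open U" and \<Phi>: "continuous_on U \<Phi>"
  shows "uniform_limit X (\<lambda>t x. \<Phi> (q t x)) (\<lambda>x. \<Phi> (Q x)) F"
proof -
  obtain N where "compact N" "N \<subseteq> U" "\<forall>\<^sub>F t in F. \<forall>x\<in>X. q t x \<in> N"
    using uniform_limit_eventually_in_compact[OF lim K U] .
  then show ?thesis
    by (intro uniform_limit_compose_uniformly_continuous_on[OF lim, of N]
        compact_uniformly_continuous continuous_on_subset[OF \<Phi>] compact_imp_closed)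
qed

lemma uniform_limit_Pair:
  assumes "uniform_limit X f l F" "uniform_limit X g m F"
  shows "uniform_limit X (\<lambda>t x. (f t x, g t x)) (\<lambda>x. (l x, m x)) F"
proof (rule uniform_limitI)
  fix e :: real assume "0 < e"
  then have "0 < e / 2" by simp
  from uniform_limitD[OF assms(1) this] uniform_limitD[OF assms(2) this]
  show "\<forall>\<^sub>F t in F. \<forall>x\<in>X. dist (f t x, g t x) (l x, m x) < e"
  proof eventually_elim
    case (elim t)
    show ?case
    proof
      fix x assume "x \<in> X"
      with elim have "dist (f t x) (l x) < e / 2" "dist (g t x) (m x) < e / 2" by auto
      then show "dist (f t x, g t x) (l x, m x) < e"
        using sqrt_sum_squares_le_sum[of "dist (f t x) (l x)" "dist (g t x) (m x)"]
        by (simp add: dist_Pair_Pair)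
    qed
  qed
qed

section \<open>Resolution of a small perturbation of an image\<close>

text \<open>
  The condition on the resolution for an arbitrary pair of images in place of the one- and two-source
  images.
\<close>

definition errors_attained ::
  "model \<Rightarrow> nat \<Rightarrow> nat \<Rightarrow> (real \<Rightarrow> real) \<Rightarrow> (real \<Rightarrow> real) \<Rightarrow> real \<Rightarrow> real \<Rightarrow> bool"
where
  "errors_attained m n t f g \<alpha> \<beta> \<longleftrightarrow> (\<exists>\<Psi>.
     most_powerful_test n (data_law m n t f) (data_law m n t g) \<alpha> \<Psi> \<and>
     (\<integral>y. \<Psi> y \<partial>data_law m n t f) = \<alpha> \<and> (\<integral>y. \<Psi> y \<partial>data_law m n t g) = 1 - \<beta>)"

text \<open>
  The value at \<open>0\<close> is the continuous extension. It makes the normalized log-likelihood weights of the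
  Poisson model a continuous function of the perturbation size up to and including size \<open>0\<close>.
\<close>

definition log1p_quotient :: "real \<Rightarrow> real" where
  "log1p_quotient z = (if z = 0 then 1 else ln (1 + z) / z)"

lemma log1p_quotient_mult: "z * log1p_quotient z = ln (1 + z)"
  by (simp add: log1p_quotient_def)

lemma continuous_log1p_quotient: "continuous_on {-1<..} log1p_quotient"
  unfolding continuous_on_eq_continuous_at[OF open_greaterThan]
proof
  fix z :: real assume z: "z \<in> {-1<..}"
  show "isCont log1p_quotient z"
  proof (cases "z = 0")
    case True
    have "DERIV ln 1 :> (1::real)" by (auto intro!: derivative_eq_intros)
    then have "((\<lambda>h. (ln (1 + h) - ln 1) / h) \<longlongrightarrow> (1::real)) (at 0)"
      by (simp add: DERIV_def)
    then have "(log1p_quotient \<longlongrightarrow> 1) (at 0)"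
      by (rule Lim_transform_eventually) (auto simp: eventually_at_filter log1p_quotient_def)
    then show ?thesis by (simp add: True isCont_def log1p_quotient_def)
  next
    case False
    have "isCont (\<lambda>z. ln (1 + z) / z) z" using z False by (intro continuous_intros) auto
    moreover have "\<forall>\<^sub>F y in nhds z. log1p_quotient y = ln (1 + y) / y"
      using t1_space_nhds[OF False] by eventually_elim (simp add: log1p_quotient_def)
    ultimately show ?thesis by (simp add: isCont_cong)
  qed
qed

text \<open>
  The images \<open>g t\<close> approach \<open>f\<close> along the direction \<open>G\<close> at speed \<open>\<eta>\<close>. The error \<open>g t - f - \<eta> t G\<close> is of
  smaller order than \<open>\<eta> t\<close>, uniformly on the unit interval.
\<close>

locale image_perturbation =
  fixes f :: "real \<Rightarrow> real" and g :: "nat \<Rightarrow> real \<Rightarrow> real" and G :: "real \<Rightarrow> real"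
    and \<eta> :: "nat \<Rightarrow> real" and n :: "nat \<Rightarrow> nat"
  assumes n_top: "filterlim n at_top sequentially"
    and cont_f: "continuous_on {0..1} f" and cont_G: "continuous_on {0..1} G"
    and cont_g: "\<forall>\<^sub>F t in sequentially. continuous_on {0..1} (g t)"
    and \<eta>_pos: "\<forall>\<^sub>F t in sequentially. 0 < \<eta> t" and \<eta>_lim: "\<eta> \<longlonglongrightarrow> 0"
    and direction: "uniform_limit {0..1} (\<lambda>t x. (g t x - f x) / \<eta> t) G sequentially"
begin

definition \<phi> :: "nat \<Rightarrow> nat \<Rightarrow> real" where
  "\<phi> t i = real (n t) * integral (bin (n t) i) f"

definition \<gamma> :: "nat \<Rightarrow> nat \<Rightarrow> real" where
  "\<gamma> t i = real (n t) * integral (bin (n t) i) (\<lambda>x. (g t x - f x) / \<eta> t)"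

text \<open>
  The averages \<open>\<phi>\<close> and \<open>\<gamma>\<close> over a bin, together with the size of the perturbation, determine the laws of the
  observation in this bin up to the known factor \<open>t / n\<close>. Every sum that enters the variance of
  the log-likelihood ratio is therefore a sum of one function \<open>\<Phi>\<close> of this triple.
\<close>

definition bin_state :: "nat \<Rightarrow> nat \<Rightarrow> real \<times> real \<times> real" where
  "bin_state t i = (\<eta> t, \<phi> t i, \<gamma> t i)"

lemma n_pos: "\<forall>\<^sub>F t in sequentially. 1 \<le> n t"
  using n_top by (auto simp: filterlim_at_top)

lemma intensities:
  "\<forall>\<^sub>F t in sequentially. \<forall>i\<in>{1..n t}.
     bin_intensity (n t) f i = \<phi> t i / real (n t) \<and>
     bin_intensity (n t) (g t) i = (\<phi> t i + \<eta> t * \<gamma> t i) / real (n t)"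
  using n_pos cont_g \<eta>_pos
proof eventually_elim
  case (elim t)
  show ?case
  proof
    fix i assume i: "i \<in> {1..n t}"
    have integrable: "k integrable_on bin (n t) i" if "continuous_on {0..1} k" for k :: "real \<Rightarrow> real"
      unfolding bin_def
      by (rule integrable_continuous_real, rule continuous_on_subset[OF that])
        (use bin_subset[OF i] in \<open>simp add: bin_def\<close>)
    have "\<eta> t * \<gamma> t i = real (n t) * (integral (bin (n t) i) (g t) - integral (bin (n t) i) f)"
      using elim integrable[OF elim(2)] integrable[OF cont_f]
      by (simp add: \<gamma>_def integral_divide Henstock_Kurzweil_Integration.integral_diff)
    then show "bin_intensity (n t) f i = \<phi> t i / real (n t) \<and>
       bin_intensity (n t) (g t) i = (\<phi> t i + \<eta> t * \<gamma> t i) / real (n t)"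
      using elim(1) by (simp add: \<phi>_def bin_intensity_def right_diff_distrib)
  qed
qed

lemma bin_state_uniform_limit:
  "uniform_limit {0<..1} (\<lambda>t x. bin_state t (bin_index (n t) x)) (\<lambda>x. (0, f x, G x)) sequentially"
  unfolding bin_state_def
proof (intro uniform_limit_Pair)
  show "uniform_limit {0<..1} (\<lambda>t x. \<eta> t) (\<lambda>x. 0) sequentially"
    using \<eta>_lim by (auto simp: uniform_limit_iff tendsto_iff)
  show "uniform_limit {0<..1} (\<lambda>t x. \<phi> t (bin_index (n t) x)) f sequentially"
    unfolding \<phi>_def using cont_f
    by (intro bin_average_uniform_limit[OF n_top] uniform_limit_const always_eventually allI)
  have "\<forall>\<^sub>F t in sequentially. continuous_on {0..1} (\<lambda>x. (g t x - f x) / \<eta> t)"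
    using cont_g \<eta>_pos by eventually_elim (intro continuous_intros cont_f, auto)
  then show "uniform_limit {0<..1} (\<lambda>t x. \<gamma> t (bin_index (n t) x)) G sequentially"
    unfolding \<gamma>_def by (rule bin_average_uniform_limit[OF n_top cont_G _ direction])
qed

lemma cont_limit_state: "continuous_on {0..1} (\<lambda>x. (0, f x, G x) :: real \<times> real \<times> real)"
  by (intro continuous_intros cont_f cont_G)

lemma limit_state_compact: "compact ((\<lambda>x. (0, f x, G x) :: real \<times> real \<times> real) ` {0..1})"
  by (rule compact_continuous_image[OF cont_limit_state]) simp

lemma bin_state_eventually_in_compact:
  assumes "open U" "\<And>x. x \<in> {0..1} \<Longrightarrow> (0, f x, G x) \<in> U"
  obtains N where "compact N" "N \<subseteq> U" "\<forall>\<^sub>F t in sequentially. \<forall>i\<in>{1..n t}. bin_state t i \<in> N"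
proof -
  obtain N where N: "compact N" "N \<subseteq> U"
    and ev: "\<forall>\<^sub>F t in sequentially. \<forall>x\<in>{0<..1}. bin_state t (bin_index (n t) x) \<in> N"
    by (rule uniform_limit_eventually_in_compact[OF bin_state_uniform_limit limit_state_compact _ _ assms(1)])
      (use assms(2) in auto)
  have "\<forall>\<^sub>F t in sequentially. \<forall>i\<in>{1..n t}. bin_state t i \<in> N"
    using ev n_pos
  proof eventually_elim
    case (elim t)
    show ?case
    proof
      fix i assume i: "i \<in> {1..n t}"
      have "real i / real (n t) \<in> bin (n t) i" "real i / real (n t) \<noteq> (real i - 1) / real (n t)"
        using elim(2) by (auto simp: bin_def divide_right_mono)
      from bin_index_unique[OF elim(2) i this] elim(1) show "bin_state t i \<in> N" by metis
    qed
  qed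
  with N show ?thesis using that by blast
qed

lemma bin_state_riemann_sum:
  fixes \<Phi> :: "real \<times> real \<times> real \<Rightarrow> real"
  assumes U: "open U" "\<And>x. x \<in> {0..1} \<Longrightarrow> (0, f x, G x) \<in> U" and \<Phi>: "continuous_on U \<Phi>"
  shows "(\<lambda>t. (\<Sum>i\<in>{1..n t}. \<Phi> (bin_state t i)) / real (n t)) \<longlonglongrightarrow> integral {0..1} (\<lambda>x. \<Phi> (0, f x, G x))"
proof (rule step_riemann_sum_tendsto[OF n_top])
  show "continuous_on {0..1} (\<lambda>x. \<Phi> (0, f x, G x))"
    by (rule continuous_on_compose2[OF \<Phi> cont_limit_state]) (use U in auto)
  show "uniform_limit {0<..1} (\<lambda>t x. \<Phi> (bin_state t (bin_index (n t) x))) (\<lambda>x. \<Phi> (0, f x, G x)) sequentially"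
    by (rule uniform_limit_compose_compact_range[OF bin_state_uniform_limit limit_state_compact _ _ U(1) \<Phi>])
      (use U(2) in auto)
qed

text \<open>
  The means differ by \<open>t \<eta> \<gamma>\<^sub>i / n\<close> in bin \<open>i\<close>, so the variance of the log-likelihood ratio is
  \<open>(t\<^sup>2 / n) \<eta>\<^sup>2\<close> times a Riemann sum of \<open>G\<^sup>2\<close>.
\<close>

theorem homogeneous_gaussian_limit:
  fixes \<alpha> \<beta> :: real
  defines "I \<equiv> integral {0..1} (\<lambda>x. (G x)\<^sup>2)"
  assumes I: "0 < I" and \<alpha>: "0 < \<alpha>" "\<alpha> < 1" and \<beta>: "0 < \<beta>" "\<beta> < 1"
    and test: "\<forall>\<^sub>F t in sequentially. errors_attained Homogeneous_Gaussian (n t) t f (g t) \<alpha> \<beta>"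
  shows "(\<lambda>t. sqrt ((real t)\<^sup>2 / real (n t)) * sqrt I * \<eta> t)
    \<longlonglongrightarrow> std_normal_quantile (1 - \<beta>) - std_normal_quantile \<alpha>"
proof (rule gaussian_resolution_limit[where n=n and
      \<mu>="\<lambda>t i. real t * bin_intensity (n t) f i" and \<nu>="\<lambda>t i. real t * bin_intensity (n t) (g t) i",
      OF _ _ \<alpha> \<beta>])
  show "\<forall>\<^sub>F t in sequentially. 0 < sqrt ((real t)\<^sup>2 / real (n t)) * sqrt I * \<eta> t"
    using n_pos \<eta>_pos eventually_gt_at_top[of 0] by eventually_elim (use I in simp)
  have "(\<lambda>t. ((\<Sum>i\<in>{1..n t}. (\<lambda>(e, p, c). c\<^sup>2) (bin_state t i)) / real (n t)) / I) \<longlonglongrightarrow> I / I"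
  proof (intro tendsto_divide tendsto_const)
    have "continuous_on UNIV (\<lambda>(e :: real, p :: real, c :: real). c\<^sup>2)"
      unfolding split_beta by (intro continuous_intros)
    from bin_state_riemann_sum[OF open_UNIV UNIV_I this]
    show "(\<lambda>t. (\<Sum>i\<in>{1..n t}. (\<lambda>(e, p, c). c\<^sup>2) (bin_state t i)) / real (n t)) \<longlonglongrightarrow> I"
      by (simp add: I_def)
  qed (use I in simp)
  moreover have "\<forall>\<^sub>F t in sequentially.
      ((\<Sum>i\<in>{1..n t}. (\<lambda>(e, p, c). c\<^sup>2) (bin_state t i)) / real (n t)) / I =
      (\<Sum>i\<in>{1..n t}. (real t * bin_intensity (n t) (g t) i - real t * bin_intensity (n t) f i)\<^sup>2) /
      (sqrt ((real t)\<^sup>2 / real (n t)) * sqrt I * \<eta> t)\<^sup>2"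
    using n_pos intensities \<eta>_pos eventually_gt_at_top[of 0]
  proof eventually_elim
    case (elim t)
    have "(\<Sum>i\<in>{1..n t}. (real t * bin_intensity (n t) (g t) i - real t * bin_intensity (n t) f i)\<^sup>2)
        = (\<Sum>i\<in>{1..n t}. (real t * \<eta> t / real (n t))\<^sup>2 * (\<gamma> t i)\<^sup>2)"
    proof (intro sum.cong refl)
      fix i assume i: "i \<in> {1..n t}"
      then have eq: "bin_intensity (n t) f i = \<phi> t i / real (n t)"
        "bin_intensity (n t) (g t) i = (\<phi> t i + \<eta> t * \<gamma> t i) / real (n t)"
        using elim(2) by auto
      have "real t * bin_intensity (n t) (g t) i - real t * bin_intensity (n t) f i
          = real t * \<eta> t / real (n t) * \<gamma> t i"
        unfolding eq by (simp add: add_divide_distrib ring_distribs)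
      then show "(real t * bin_intensity (n t) (g t) i - real t * bin_intensity (n t) f i)\<^sup>2
          = (real t * \<eta> t / real (n t))\<^sup>2 * (\<gamma> t i)\<^sup>2"
        by (simp only: power_mult_distrib)
    qed
    also have "\<dots> = (real t * \<eta> t / real (n t))\<^sup>2 * (\<Sum>i\<in>{1..n t}. (\<gamma> t i)\<^sup>2)"
      by (rule sum_distrib_left[symmetric])
    finally show ?case
      using elim I by (simp add: bin_state_def power_mult_distrib) (simp add: power2_eq_square field_simps)
  qed
  ultimately show "(\<lambda>t. (\<Sum>i\<in>{1..n t}.
      (real t * bin_intensity (n t) (g t) i - real t * bin_intensity (n t) f i)\<^sup>2) /
      (sqrt ((real t)\<^sup>2 / real (n t)) * sqrt I * \<eta> t)\<^sup>2) \<longlonglongrightarrow> 1"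
    using I by (simp add: tendsto_cong)
qed (use test in \<open>simp add: errors_attained_def data_law_def\<close>)

text \<open>
  The square roots linearize: \<open>2 (\<surd>p' - \<surd>p) = 2 (p' - p) / (\<surd>p + \<surd>p')\<close>, and \<open>\<surd>p + \<surd>p'\<close> tends to
  \<open>2 \<surd>f\<close> because the perturbation vanishes in the limit. Positivity of \<open>f\<close> keeps the quotient
  continuous.
\<close>

theorem variance_stabilized_gaussian_limit:
  fixes \<alpha> \<beta> :: real
  defines "I \<equiv> integral {0..1} (\<lambda>x. (G x)\<^sup>2 / f x)"
  assumes f_pos: "\<And>x. x \<in> {0..1} \<Longrightarrow> 0 < f x"
    and I: "0 < I" and \<alpha>: "0 < \<alpha>" "\<alpha> < 1" and \<beta>: "0 < \<beta>" "\<beta> < 1"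
    and test: "\<forall>\<^sub>F t in sequentially. errors_attained Variance_Stabilized_Gaussian (n t) t f (g t) \<alpha> \<beta>"
  shows "(\<lambda>t. sqrt (real t) * sqrt I * \<eta> t) \<longlonglongrightarrow> std_normal_quantile (1 - \<beta>) - std_normal_quantile \<alpha>"
proof (rule gaussian_resolution_limit[where n=n and
      \<mu>="\<lambda>t i. 2 * sqrt (real t * bin_intensity (n t) f i)" and
      \<nu>="\<lambda>t i. 2 * sqrt (real t * bin_intensity (n t) (g t) i)", OF _ _ \<alpha> \<beta>])
  define U :: "(real \<times> real \<times> real) set" where "U = {(e, p, c). 0 < p \<and> 0 < p + e * c}"
  define \<Phi> :: "real \<times> real \<times> real \<Rightarrow> real" where "\<Phi> = (\<lambda>(e, p, c). (2 * c / (sqrt p + sqrt (p + e * c)))\<^sup>2)"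
  have U: "open U" unfolding U_def split_beta
    by (intro open_Collect_conj open_Collect_less continuous_intros)
  have in_U: "(0, f x, G x) \<in> U" if "x \<in> {0..1}" for x using f_pos[OF that] by (simp add: U_def)
  show "\<forall>\<^sub>F t in sequentially. 0 < sqrt (real t) * sqrt I * \<eta> t"
    using \<eta>_pos eventually_gt_at_top[of 0] by eventually_elim (use I in simp)
  have "continuous_on U \<Phi>"
    unfolding \<Phi>_def split_beta
    by (intro continuous_intros) (auto simp: U_def intro!: less_imp_neq[THEN not_sym] add_pos_pos)
  note bin_state_riemann_sum[OF U in_U this]
  also have "integral {0..1} (\<lambda>x. \<Phi> (0, f x, G x)) = I"
    unfolding I_def
  proof (rule integral_cong)
    fix x :: real assume "x \<in> {0..1}"
    from f_pos[OF this] show "\<Phi> (0, f x, G x) = (G x)\<^sup>2 / f x"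
      by (simp add: \<Phi>_def power_divide power_mult_distrib)
  qed
  finally have "(\<lambda>t. ((\<Sum>i\<in>{1..n t}. \<Phi> (bin_state t i)) / real (n t)) / I) \<longlonglongrightarrow> I / I"
    using I by (intro tendsto_divide) auto
  moreover obtain N where "N \<subseteq> U" and ev_N: "\<forall>\<^sub>F t in sequentially. \<forall>i\<in>{1..n t}. bin_state t i \<in> N"
    by (rule bin_state_eventually_in_compact[OF U in_U])
  have "\<forall>\<^sub>F t in sequentially.
      ((\<Sum>i\<in>{1..n t}. \<Phi> (bin_state t i)) / real (n t)) / I =
      (\<Sum>i\<in>{1..n t}. (2 * sqrt (real t * bin_intensity (n t) (g t) i) - 2 * sqrt (real t * bin_intensity (n t) f i))\<^sup>2) /
      (sqrt (real t) * sqrt I * \<eta> t)\<^sup>2"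
    using n_pos intensities \<eta>_pos eventually_gt_at_top[of 0] ev_N
  proof eventually_elim
    case (elim t)
    have "(2 * sqrt (real t * bin_intensity (n t) (g t) i) - 2 * sqrt (real t * bin_intensity (n t) f i))\<^sup>2
        = (real t * (\<eta> t)\<^sup>2 / real (n t)) * \<Phi> (bin_state t i)" if i: "i \<in> {1..n t}" for i
    proof -
      define p p' where "p = \<phi> t i" and "p' = \<phi> t i + \<eta> t * \<gamma> t i"
      have pos: "0 < p" "0 < p'"
        using elim(5) i \<open>N \<subseteq> U\<close> by (auto simp: U_def bin_state_def p_def p'_def)
      have "2 * sqrt (real t * bin_intensity (n t) (g t) i) - 2 * sqrt (real t * bin_intensity (n t) f i)
          = sqrt (real t / real (n t)) * (2 * (sqrt p' - sqrt p))"
      proof -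
        have eq: "bin_intensity (n t) f i = p / real (n t)" "bin_intensity (n t) (g t) i = p' / real (n t)"
          using elim(2) i by (auto simp: p_def p'_def)
        have "sqrt (real t * (q / real (n t))) = sqrt (real t / real (n t)) * sqrt q" for q
          by (simp add: real_sqrt_mult real_sqrt_divide)
        then show ?thesis unfolding eq by (simp add: right_diff_distrib)
      qed
      also have "sqrt p' - sqrt p = (p' - p) / (sqrt p + sqrt p')"
        using pos by (simp add: field_simps add_pos_pos less_imp_neq[THEN not_sym])
      also have "p' - p = \<eta> t * \<gamma> t i" by (simp add: p_def p'_def)
      finally show ?thesis
        using elim by (simp add: \<Phi>_def bin_state_def p_def p'_def power_mult_distrib power_divide)
    qed
    then have "(\<Sum>i\<in>{1..n t}. (2 * sqrt (real t * bin_intensity (n t) (g t) i) - 2 * sqrt (real t * bin_intensity (n t) f i))\<^sup>2)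
        = real t * (\<eta> t)\<^sup>2 / real (n t) * (\<Sum>i\<in>{1..n t}. \<Phi> (bin_state t i))"
      unfolding sum_distrib_left by (intro sum.cong refl) blast
    then show ?case
      using elim I by (simp add: power_mult_distrib)
  qed
  ultimately show "(\<lambda>t. (\<Sum>i\<in>{1..n t}.
      (2 * sqrt (real t * bin_intensity (n t) (g t) i) - 2 * sqrt (real t * bin_intensity (n t) f i))\<^sup>2) /
      (sqrt (real t) * sqrt I * \<eta> t)\<^sup>2) \<longlonglongrightarrow> 1"
    using I by (simp add: tendsto_cong)
qed (use test in \<open>simp add: errors_attained_def data_law_def\<close>)

text \<open>
  The weights of the log-likelihood ratio are \<open>ln (1 + \<eta> \<gamma>\<^sub>i / \<phi>\<^sub>i) = \<eta> \<rho>\<^sub>i\<close> with bounded \<open>\<rho>\<^sub>i\<close>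
  close to \<open>G / f\<close>. All three sums in \<open>poisson_resolution_limit\<close> therefore have the leading term
  \<open>t \<eta>\<^sup>2 \<integral> G\<^sup>2 / f\<close>. The normalized weights are of order \<open>t\<^sup>-\<^sup>1\<^sup>/\<^sup>2\<close> whatever \<open>\<eta>\<close> is, because \<open>\<eta>\<close> cancels.
\<close>

theorem poisson_limit:
  fixes \<alpha> \<beta> :: real
  defines "I \<equiv> integral {0..1} (\<lambda>x. (G x)\<^sup>2 / f x)"
  assumes f_pos: "\<And>x. x \<in> {0..1} \<Longrightarrow> 0 < f x"
    and I: "0 < I" and \<alpha>: "0 < \<alpha>" "\<alpha> < 1" and \<beta>: "0 < \<beta>" "\<beta> < 1"
    and test: "\<forall>\<^sub>F t in sequentially. errors_attained Poisson (n t) t f (g t) \<alpha> \<beta>"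
  shows "(\<lambda>t. sqrt (real t) * sqrt I * \<eta> t) \<longlonglongrightarrow> std_normal_quantile (1 - \<beta>) - std_normal_quantile \<alpha>"
proof -
  define U :: "(real \<times> real \<times> real) set" where "U = {(e, p, c). 0 < p \<and> 0 < p + e * c}"
  define \<rho> :: "real \<times> real \<times> real \<Rightarrow> real" where
    "\<rho> = (\<lambda>(e, p, c). c / p * log1p_quotient (e * c / p))"
  have U: "open U" unfolding U_def split_beta
    by (intro open_Collect_conj open_Collect_less continuous_intros)
  have in_U: "(0, f x, G x) \<in> U" if "x \<in> {0..1}" for x using f_pos[OF that] by (simp add: U_def)
  have \<rho>: "continuous_on U \<rho>"
    unfolding \<rho>_def split_beta
    by (intro continuous_intros continuous_on_compose2[OF continuous_log1p_quotient])
      (auto simp: U_def field_simps)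
  have \<rho>0: "\<rho> (0, f x, G x) = G x / f x" for x by (simp add: \<rho>_def log1p_quotient_def)
  let ?base = "\<lambda>t i. real t * bin_intensity (n t) f i" and ?alt = "\<lambda>t i. real t * bin_intensity (n t) (g t) i"
  let ?r = "\<lambda>t i. ln (?alt t i / ?base t i)" and ?s = "\<lambda>t. sqrt (real t) * sqrt I * \<eta> t"
  obtain N where N: "compact N" "N \<subseteq> U" and ev_N: "\<forall>\<^sub>F t in sequentially. \<forall>i\<in>{1..n t}. bin_state t i \<in> N"
    by (rule bin_state_eventually_in_compact[OF U in_U])
  have "bounded (\<rho> ` N)"
    by (intro compact_imp_bounded compact_continuous_image continuous_on_subset[OF \<rho>] N)
  then obtain C where C: "\<And>q. q \<in> N \<Longrightarrow> \<bar>\<rho> q\<bar> \<le> C" by (auto simp: bounded_iff)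

  have rates: "\<forall>\<^sub>F t in sequentially. 0 < t \<and> 0 < \<eta> t \<and> 1 \<le> n t \<and> (\<forall>i\<in>{1..n t}.
      bin_state t i \<in> N \<and> 0 < ?base t i \<and> 0 < ?alt t i \<and>
      ?base t i = real t / real (n t) * \<phi> t i \<and> ?alt t i = real t / real (n t) * (\<phi> t i + \<eta> t * \<gamma> t i) \<and>
      ?r t i = \<eta> t * \<rho> (bin_state t i))"
    using n_pos intensities \<eta>_pos eventually_gt_at_top[of 0] ev_N
  proof eventually_elim
    case (elim t)
    have "bin_state t i \<in> N \<and> 0 < ?base t i \<and> 0 < ?alt t i \<and>
      ?base t i = real t / real (n t) * \<phi> t i \<and> ?alt t i = real t / real (n t) * (\<phi> t i + \<eta> t * \<gamma> t i) \<and>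
      ?r t i = \<eta> t * \<rho> (bin_state t i)" if i: "i \<in> {1..n t}" for i
    proof -
      have N_i: "bin_state t i \<in> N" using elim(5) i by blast
      then have pos: "0 < \<phi> t i" "0 < \<phi> t i + \<eta> t * \<gamma> t i"
        using N by (auto simp: U_def bin_state_def)
      have eq: "?base t i = real t / real (n t) * \<phi> t i" "?alt t i = real t / real (n t) * (\<phi> t i + \<eta> t * \<gamma> t i)"
        using elim(2) i by simp_all
      have "?alt t i / ?base t i = 1 + \<eta> t * \<gamma> t i / \<phi> t i"
        unfolding eq using elim pos by (simp add: field_simps)
      then have "?r t i = \<eta> t * \<rho> (bin_state t i)"
        by (simp add: \<rho>_def bin_state_def flip: log1p_quotient_mult)
      with N_i eq pos elim show ?thesis by simp
    qed
    with elim show ?case by blast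
  qed

  have sums: "(\<lambda>t. (\<Sum>i\<in>{1..n t}. a t i) / (?s t)\<^sup>2) \<longlonglongrightarrow> 1"
    if a: "\<forall>\<^sub>F t in sequentially. \<forall>i\<in>{1..n t}. a t i = real t * (\<eta> t)\<^sup>2 / real (n t) * \<Phi> (bin_state t i)"
      and \<Phi>: "continuous_on U \<Phi>" and \<Phi>0: "\<And>x. x \<in> {0..1} \<Longrightarrow> \<Phi> (0, f x, G x) = (G x)\<^sup>2 / f x"
    for a \<Phi>
  proof -
    have "(\<lambda>t. ((\<Sum>i\<in>{1..n t}. \<Phi> (bin_state t i)) / real (n t)) / I) \<longlonglongrightarrow> I / I"
    proof (intro tendsto_divide tendsto_const)
      have "integral {0..1} (\<lambda>x. \<Phi> (0, f x, G x)) = I"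
        unfolding I_def by (rule integral_cong) (rule \<Phi>0)
      with bin_state_riemann_sum[OF U in_U \<Phi>]
      show "(\<lambda>t. (\<Sum>i\<in>{1..n t}. \<Phi> (bin_state t i)) / real (n t)) \<longlonglongrightarrow> I" by simp
    qed (use I in simp)
    moreover have "\<forall>\<^sub>F t in sequentially. ((\<Sum>i\<in>{1..n t}. \<Phi> (bin_state t i)) / real (n t)) / I
        = (\<Sum>i\<in>{1..n t}. a t i) / (?s t)\<^sup>2"
      using a rates
    proof eventually_elim
      case (elim t)
      then have "(\<Sum>i\<in>{1..n t}. a t i) = real t * (\<eta> t)\<^sup>2 / real (n t) * (\<Sum>i\<in>{1..n t}. \<Phi> (bin_state t i))"
        unfolding sum_distrib_left by (intro sum.cong refl) blast
      moreover have "0 < t" "0 < \<eta> t" "1 \<le> n t" using elim by blast+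
      ultimately show ?case using I by (simp add: power_mult_distrib)
    qed
    ultimately show ?thesis using I by (simp add: tendsto_cong)
  qed

  show ?thesis
  proof (rule poisson_resolution_limit[where n=n and \<theta>="?base" and \<theta>'="?alt", OF _ _ _ _ _ _ _ \<alpha> \<beta>])
    show "\<forall>\<^sub>F t in sequentially. 0 < ?s t"
      using rates by eventually_elim (use I in simp)
    show "\<forall>\<^sub>F t in sequentially. \<forall>i\<in>{1..n t}. 0 < ?base t i \<and> 0 < ?alt t i"
      using rates by eventually_elim blast
    show "\<forall>\<^sub>F t in sequentially. \<forall>i\<in>{1..n t}. \<bar>?r t i / ?s t\<bar> \<le> C / (sqrt (real t) * sqrt I)"
      using rates
    proof eventually_elim
      case (elim t)
      show ?case
      proof
        fix i assume i: "i \<in> {1..n t}"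
        have "\<bar>?r t i / ?s t\<bar> = \<bar>\<rho> (bin_state t i)\<bar> / (sqrt (real t) * sqrt I)"
        proof -
          have r: "?r t i = \<eta> t * \<rho> (bin_state t i)" and "0 < \<eta> t" using elim i by blast+
          then show ?thesis unfolding r using I by (simp add: abs_mult)
        qed
        also have "\<dots> \<le> C / (sqrt (real t) * sqrt I)"
          using elim i I by (intro divide_right_mono C) auto
        finally show "\<bar>?r t i / ?s t\<bar> \<le> C / (sqrt (real t) * sqrt I)" .
      qed
    qed
    show "(\<lambda>t. C / (sqrt (real t) * sqrt I)) \<longlonglongrightarrow> 0"
      using I by (intro tendsto_divide_0[OF tendsto_const] filterlim_at_top_imp_at_infinity
          filterlim_at_top_mult_tendsto_pos[OF tendsto_const]
          filterlim_compose[OF sqrt_at_top] filterlim_real_sequentially) auto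
    show "(\<lambda>t. (\<Sum>i\<in>{1..n t}. (?r t i)\<^sup>2 * ?base t i) / (?s t)\<^sup>2) \<longlonglongrightarrow> 1"
    proof (rule sums[where \<Phi>="\<lambda>q. (\<rho> q)\<^sup>2 * fst (snd q)"])
      show "\<forall>\<^sub>F t in sequentially. \<forall>i\<in>{1..n t}. (?r t i)\<^sup>2 * ?base t i =
          real t * (\<eta> t)\<^sup>2 / real (n t) * ((\<rho> (bin_state t i))\<^sup>2 * fst (snd (bin_state t i)))"
        using rates
      proof eventually_elim
        case (elim t)
        show ?case
        proof
          fix i assume "i \<in> {1..n t}"
          with elim have eqs: "?r t i = \<eta> t * \<rho> (bin_state t i)"
            "?base t i = real t / real (n t) * \<phi> t i" "?alt t i = real t / real (n t) * (\<phi> t i + \<eta> t * \<gamma> t i)"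
            by blast+
          show "(?r t i)\<^sup>2 * ?base t i =
              real t * (\<eta> t)\<^sup>2 / real (n t) * ((\<rho> (bin_state t i))\<^sup>2 * fst (snd (bin_state t i)))"
            unfolding eqs(1) unfolding eqs(2,3) by (simp add: bin_state_def power2_eq_square algebra_simps)
        qed
      qed
    qed (auto intro!: continuous_intros \<rho> simp: \<rho>0 power2_eq_square)
    show "(\<lambda>t. (\<Sum>i\<in>{1..n t}. (?r t i)\<^sup>2 * ?alt t i) / (?s t)\<^sup>2) \<longlonglongrightarrow> 1"
    proof (rule sums[where \<Phi>="\<lambda>q. (\<rho> q)\<^sup>2 * (fst (snd q) + fst q * snd (snd q))"])
      show "\<forall>\<^sub>F t in sequentially. \<forall>i\<in>{1..n t}. (?r t i)\<^sup>2 * ?alt t i =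
          real t * (\<eta> t)\<^sup>2 / real (n t) * ((\<rho> (bin_state t i))\<^sup>2 *
            (fst (snd (bin_state t i)) + fst (bin_state t i) * snd (snd (bin_state t i))))"
        using rates
      proof eventually_elim
        case (elim t)
        show ?case
        proof
          fix i assume "i \<in> {1..n t}"
          with elim have eqs: "?r t i = \<eta> t * \<rho> (bin_state t i)"
            "?base t i = real t / real (n t) * \<phi> t i" "?alt t i = real t / real (n t) * (\<phi> t i + \<eta> t * \<gamma> t i)"
            by blast+
          show "(?r t i)\<^sup>2 * ?alt t i =
              real t * (\<eta> t)\<^sup>2 / real (n t) * ((\<rho> (bin_state t i))\<^sup>2 *
                (fst (snd (bin_state t i)) + fst (bin_state t i) * snd (snd (bin_state t i))))"
            unfolding eqs(1) unfolding eqs(2,3) by (simp add: bin_state_def power2_eq_square algebra_simps)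
        qed
      qed
    qed (auto intro!: continuous_intros \<rho> simp: \<rho>0 power2_eq_square)
    show "(\<lambda>t. (\<Sum>i\<in>{1..n t}. ?r t i * (?alt t i - ?base t i)) / (?s t)\<^sup>2) \<longlonglongrightarrow> 1"
    proof (rule sums[where \<Phi>="\<lambda>q. \<rho> q * snd (snd q)"])
      show "\<forall>\<^sub>F t in sequentially. \<forall>i\<in>{1..n t}. ?r t i * (?alt t i - ?base t i) =
          real t * (\<eta> t)\<^sup>2 / real (n t) * (\<rho> (bin_state t i) * snd (snd (bin_state t i)))"
        using rates
      proof eventually_elim
        case (elim t)
        show ?case
        proof
          fix i assume "i \<in> {1..n t}"
          with elim have eqs: "?r t i = \<eta> t * \<rho> (bin_state t i)"
            "?base t i = real t / real (n t) * \<phi> t i" "?alt t i = real t / real (n t) * (\<phi> t i + \<eta> t * \<gamma> t i)"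
            by blast+
          show "?r t i * (?alt t i - ?base t i) =
              real t * (\<eta> t)\<^sup>2 / real (n t) * (\<rho> (bin_state t i) * snd (snd (bin_state t i)))"
            unfolding eqs(1) unfolding eqs(2,3) by (simp add: bin_state_def power2_eq_square algebra_simps)
        qed
      qed
    qed (auto intro!: continuous_intros \<rho> simp: \<rho>0 power2_eq_square)
  qed (use test in \<open>simp add: errors_attained_def data_law_def\<close>)
qed

end

section \<open>Splitting a source as a perturbation\<close>

text \<open>
  Existence of the derivatives is stated with \<open>deriv\<close> itself, since the limiting constant involves
  \<open>deriv (deriv h)\<close>.
\<close>

definition C2_at :: "(real \<Rightarrow> real) \<Rightarrow> real \<Rightarrow> bool" where
  "C2_at h y \<longleftrightarrow> (h has_real_derivative deriv h y) (at y) \<and>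
     (deriv h has_real_derivative deriv (deriv h) y) (at y) \<and> isCont (deriv (deriv h)) y"

lemma Ck_on_mono: "Ck_on k f S \<Longrightarrow> j \<le> k \<Longrightarrow> Ck_on j f S"
  unfolding Ck_on_def by (erule exE, rule_tac x=D in exI) auto

lemma C2_at_if_Ck_on_shift:
  assumes "Ck_on 2 (\<lambda>x. h (x - z)) {0..1}" and y: "- z < y" "y < 1 - z"
  shows "C2_at h y"
proof -
  obtain D where D0: "\<And>x. x \<in> {0..1} \<Longrightarrow> D 0 x = h (x - z)"
    and D: "\<And>j x. j < 2 \<Longrightarrow> x \<in> {0..1} \<Longrightarrow> (D j has_real_derivative D (Suc j) x) (at x within {0..1})"
    and D2: "\<And>j. j \<le> 2 \<Longrightarrow> continuous_on {0..1} (D j)"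
    using assms(1) unfolding Ck_on_def by blast
  define S where "S = {- z<..<1 - z}"
  have S: "open S" "y \<in> S" using y by (auto simp: S_def)
  have shift: "((\<lambda>w. D j (w + z)) has_real_derivative D (Suc j) (w + z)) (at w)"
    if "w \<in> S" "j < 2" for j w
  proof -
    have "at (w + z) within {0..1} = at (w + z)"
      using that(1) by (intro at_within_interior) (auto simp: S_def)
    then have "(D j has_real_derivative D (Suc j) (w + z)) (at (w + z))"
      using D[OF that(2), of "w + z"] that(1) by (simp add: S_def)
    then show ?thesis by (simp add: DERIV_shift)
  qed
  have h: "(h has_real_derivative D 1 (w + z)) (at w)" if "w \<in> S" for w
  proof (rule has_field_derivative_transform_within_open[OF _ S(1) that])
    show "((\<lambda>w. D 0 (w + z)) has_real_derivative D 1 (w + z)) (at w)"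
      using shift[OF that, of 0] by simp
  qed (simp add: D0 S_def)
  have h': "(deriv h has_real_derivative D 2 (w + z)) (at w)" if "w \<in> S" for w
  proof (rule has_field_derivative_transform_within_open[OF _ S(1) that])
    show "((\<lambda>w. D 1 (w + z)) has_real_derivative D 2 (w + z)) (at w)"
      using shift[OF that, of 1] by (simp add: numeral_2_eq_2)
  qed (simp add: DERIV_imp_deriv[OF h])
  have "continuous_on S (\<lambda>w. D 2 (w + z))"
    by (intro continuous_on_compose2[OF D2[of 2]] continuous_intros) (auto simp: S_def)
  then have "continuous_on S (deriv (deriv h))"
    using DERIV_imp_deriv[OF h'] by (simp cong: continuous_on_cong)
  then have "isCont (deriv (deriv h)) y"
    using S by (simp add: continuous_on_eq_continuous_at)
  with h[OF S(2)] h'[OF S(2)] DERIV_imp_deriv[OF h[OF S(2)]] DERIV_imp_deriv[OF h'[OF S(2)]]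
  show ?thesis by (simp add: C2_at_def)
qed

text \<open>
  Smoothness of \<open>h\<close> shifted to one source gives information on \<open>h\<close> in a unit interval only, and two-sided
  derivatives in its interior only. The three shifted intervals overlap and cover a
  neighbourhood of the closed interval on which the null image sees \<open>h\<close>.
\<close>

lemma C2_at_if_Ck_on_three_shifts:
  assumes Ck: "Ck_on 2 (\<lambda>x. h (x - x0)) {0..1}" "Ck_on 2 (\<lambda>x. h (x - (x0 - e))) {0..1}"
      "Ck_on 2 (\<lambda>x. h (x - (x0 + e))) {0..1}"
    and e: "0 < e" "e < 1" and y: "- x0 - e < y" "y < 1 - x0 + e"
  shows "C2_at h y"
proof -
  consider "y < 1 - x0 - e" | "- x0 < y \<and> y < 1 - x0" | "- x0 + e < y"
    using e by linarith
  then show ?thesis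
    using C2_at_if_Ck_on_shift[OF Ck(1)] C2_at_if_Ck_on_shift[OF Ck(2)] C2_at_if_Ck_on_shift[OF Ck(3)] y
    by cases (auto simp: algebra_simps)
qed

text \<open>
  Expand to second order on both sides of \<open>y\<close>; the first-order terms cancel.
\<close>

lemma symmetric_second_difference:
  assumes C2: "\<And>w. w \<in> {y - e..y + e} \<Longrightarrow> C2_at h w" and "0 < e"
  obtains u v where "\<bar>u - y\<bar> < e" "\<bar>v - y\<bar> < e"
    "(h (y - e) + h (y + e)) / 2 - h y = e\<^sup>2 / 2 * ((deriv (deriv h) u + deriv (deriv h) v) / 2)"
proof -
  define diff where "diff m = (deriv ^^ m) h" for m :: nat
  have diff: "diff 0 = h" "diff (Suc 0) = deriv h" "diff 2 = deriv (deriv h)"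
    by (simp_all add: diff_def numeral_2_eq_2)
  have D: "\<forall>m t. m < 2 \<and> y - e \<le> t \<and> t \<le> y + e \<longrightarrow> DERIV (diff m) t :> diff (Suc m) t"
    using C2 by (auto simp: less_2_cases_iff diff C2_at_def numeral_2_eq_2[symmetric])
  obtain v where v: "y < v" "v < y + e"
      "h (y + e) = (\<Sum>m<2. diff m y / fact m * (y + e - y) ^ m) + diff 2 v / fact 2 * (y + e - y) ^ 2"
    using Taylor_up[of 2 diff h "y - e" "y + e" y] D diff(1) \<open>0 < e\<close> by auto
  obtain u where u: "y - e < u" "u < y"
      "h (y - e) = (\<Sum>m<2. diff m y / fact m * (y - e - y) ^ m) + diff 2 u / fact 2 * (y - e - y) ^ 2"
    using Taylor_down[of 2 diff h "y - e" "y + e" y] D diff(1) \<open>0 < e\<close> by auto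
  have "(h (y - e) + h (y + e)) / 2 - h y = e\<^sup>2 / 2 * ((deriv (deriv h) u + deriv (deriv h) v) / 2)"
    unfolding u(3) v(3) by (simp add: numeral_2_eq_2 diff[unfolded numeral_2_eq_2] field_simps)
  with u v show ?thesis by (intro that[of u v]) auto
qed

text \<open>
  With \<open>e = d / 2\<close> the leading factor \<open>e\<^sup>2 / 2\<close> of the second difference equals \<open>d\<^sup>2 / 8\<close>, and the
  intermediate points are moved to \<open>x - x0\<close> by uniform continuity of the second derivative.
\<close>

lemma second_difference_uniform_limit:
  assumes C2: "\<And>y. - x0 - \<delta> \<le> y \<Longrightarrow> y \<le> 1 - x0 + \<delta> \<Longrightarrow> C2_at h y" and "0 < \<delta>"
    and d: "d \<longlonglongrightarrow> 0" and d_pos: "\<forall>\<^sub>F t in sequentially. 0 < d t"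
  shows "uniform_limit {0..1}
    (\<lambda>t x. (alternative_image h (x0 - d t / 2) (x0 + d t / 2) x - null_image h x0 x) / ((d t)\<^sup>2 / 8))
    (\<lambda>x. deriv (deriv h) (x - x0)) sequentially"
proof (rule uniform_limitI)
  fix \<epsilon> :: real assume "0 < \<epsilon>"
  let ?H = "deriv (deriv h)" and ?J = "{- x0 - \<delta>..1 - x0 + \<delta>}"
  have "continuous_on ?J ?H"
    using C2 by (intro continuous_at_imp_continuous_on ballI) (auto simp: C2_at_def)
  then have "uniformly_continuous_on ?J ?H" by (intro compact_uniformly_continuous) auto
  then obtain \<tau> where "0 < \<tau>" and \<tau>: "\<And>y w. y \<in> ?J \<Longrightarrow> w \<in> ?J \<Longrightarrow> dist w y < \<tau> \<Longrightarrow> dist (?H w) (?H y) < \<epsilon>"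
    unfolding uniformly_continuous_on_def using \<open>0 < \<epsilon>\<close> by meson
  have "\<forall>\<^sub>F t in sequentially. d t < 2 * min \<delta> \<tau>"
    using \<open>0 < \<delta>\<close> \<open>0 < \<tau>\<close> by (intro order_tendstoD[OF d]) simp
  with d_pos show "\<forall>\<^sub>F t in sequentially. \<forall>x\<in>{0..1}.
    dist ((alternative_image h (x0 - d t / 2) (x0 + d t / 2) x - null_image h x0 x) / ((d t)\<^sup>2 / 8)) (?H (x - x0)) < \<epsilon>"
  proof eventually_elim
    case (elim t)
    define e where "e = d t / 2"
    have e: "0 < e" "e < \<delta>" "e < \<tau>" using elim by (auto simp: e_def)
    show ?case
    proof
      fix x :: real assume x: "x \<in> {0..1}"
      have "C2_at h w" if "w \<in> {x - x0 - e..x - x0 + e}" for w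
        using that x e by (intro C2) auto
      then obtain u v where uv: "\<bar>u - (x - x0)\<bar> < e" "\<bar>v - (x - x0)\<bar> < e"
        and eq: "(h (x - x0 - e) + h (x - x0 + e)) / 2 - h (x - x0) = e\<^sup>2 / 2 * ((?H u + ?H v) / 2)"
        using symmetric_second_difference[OF _ e(1)] by metis
      have shift: "alternative_image h (x0 - e) (x0 + e) x - null_image h x0 x = e\<^sup>2 / 2 * ((?H u + ?H v) / 2)"
        unfolding eq[symmetric] alternative_image_def null_image_def by (simp add: algebra_simps add_divide_distrib)
      have width: "(d t)\<^sup>2 / 8 = e\<^sup>2 / 2" by (simp add: e_def power2_eq_square)
      have "(alternative_image h (x0 - d t / 2) (x0 + d t / 2) x - null_image h x0 x) / ((d t)\<^sup>2 / 8)
          = (?H u + ?H v) / 2"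
        unfolding e_def[symmetric] shift width using e(1) by simp
      moreover have "dist (?H w) (?H (x - x0)) < \<epsilon>" if "\<bar>w - (x - x0)\<bar> < e" for w
        by (rule \<tau>) (use that x e in \<open>auto simp: dist_real_def abs_less_iff\<close>)
      from this[OF uv(1)] this[OF uv(2)] have "\<bar>(?H u + ?H v) / 2 - ?H (x - x0)\<bar> < \<epsilon>"
        by (auto simp: dist_real_def abs_less_iff field_simps)
      ultimately show "dist ((alternative_image h (x0 - d t / 2) (x0 + d t / 2) x - null_image h x0 x) / ((d t)\<^sup>2 / 8))
          (?H (x - x0)) < \<epsilon>"
        by (simp only: dist_real_def)
    qed
  qed
qed

text \<open>
  If the second derivative vanishes, \<open>h\<close> is affine on an interval with \<open>0\<close> in its interior, and
  evenness makes the slope zero.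
\<close>

lemma even_second_derivative_nonzero:
  fixes h :: "real \<Rightarrow> real"
  assumes even: "\<And>x. h (- x) = h x" and x0: "0 < x0" "x0 < 1"
    and nonconst: "\<not> (\<lambda>x. h (x - x0)) constant_on {0..1}"
    and C2: "\<And>y. - x0 \<le> y \<Longrightarrow> y \<le> 1 - x0 \<Longrightarrow> C2_at h y"
  shows "\<exists>x\<in>{0..1}. deriv (deriv h) (x - x0) \<noteq> 0"
proof (rule ccontr)
  assume "\<not> ?thesis"
  then have zero: "deriv (deriv h) y = 0" if "y \<in> {- x0..1 - x0}" for y
    using that by (auto dest!: bspec[of _ _ "y + x0"])
  have "(deriv h has_field_derivative 0) (at y within {- x0..1 - x0})" if "y \<in> {- x0..1 - x0}" for y
    using C2[of y] zero[OF that] that by (auto simp: C2_at_def intro: has_field_derivative_at_within)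
  then obtain c where c: "\<And>y. y \<in> {- x0..1 - x0} \<Longrightarrow> deriv h y = c"
    using has_field_derivative_zero_constant[of "{- x0..1 - x0}" "deriv h"] by auto
  have d0: "(h has_real_derivative c) (at 0)"
    using C2[of 0] c[of 0] x0 by (simp add: C2_at_def)
  then have "((\<lambda>x. h (- x)) has_real_derivative - c) (at 0)"
    using DERIV_mirror[where f=h and x=0 and y=c] by simp
  then have "c = - c" using d0 by (intro DERIV_unique[of h]) (simp_all add: even)
  then have "c = 0" by simp
  have "(h has_field_derivative 0) (at y within {- x0..1 - x0})" if "y \<in> {- x0..1 - x0}" for y
    using C2[of y] c[OF that] that \<open>c = 0\<close> by (auto simp: C2_at_def intro: has_field_derivative_at_within)
  then obtain k where "\<And>y. y \<in> {- x0..1 - x0} \<Longrightarrow> h y = k"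
    using has_field_derivative_zero_constant[of "{- x0..1 - x0}" h] by auto
  then have "(\<lambda>x. h (x - x0)) constant_on {0..1}"
    unfolding constant_on_def by (intro exI[of _ k]) auto
  with nonconst show False by blast
qed

lemma integral_weighted_square_pos:
  fixes G f :: "real \<Rightarrow> real"
  assumes "continuous_on {0..1} G" "continuous_on {0..1} f" "\<And>x. x \<in> {0..1} \<Longrightarrow> 0 < f x"
    and "\<exists>x\<in>{0..1}. G x \<noteq> 0"
  shows "0 < integral {0..1} (\<lambda>x. (G x)\<^sup>2 / f x)"
proof -
  have "f x \<noteq> 0" if "x \<in> {0..1}" for x
    using assms(3)[OF that] by simp
  then have c: "continuous_on {0..1} (\<lambda>x. (G x)\<^sup>2 / f x)"
    using assms(1,2) by (intro continuous_intros) auto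
  have nn: "0 \<le> (G x)\<^sup>2 / f x" if "x \<in> {0..1}" for x
    using assms(3)[OF that] by simp
  have "integral {0..1} (\<lambda>x. (G x)\<^sup>2 / f x) \<noteq> 0"
    using integral_eq_0_iff[OF c _ nn] assms(3,4) by (fastforce simp: less_imp_neq)
  moreover have "0 \<le> integral {0..1} (\<lambda>x. (G x)\<^sup>2 / f x)"
    by (rule integral_nonneg[OF integrable_continuous_real[OF c] nn])
  ultimately show ?thesis by simp
qed

section \<open>The statistical resolution\<close>

text \<open>
  The positions of the sources are determined by \<open>x0\<close> and \<open>d\<close> up to exchange, which does not change the image.
\<close>

lemma attains_errors_imp_errors_attained:
  assumes "attains_errors m h x0 n t \<alpha> \<beta> d" "0 < d"
  shows "errors_attained m n t (null_image h x0) (alternative_image h (x0 - d / 2) (x0 + d / 2)) \<alpha> \<beta>"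
proof -
  obtain x1 x2 \<Psi> where x: "\<bar>x1 - x2\<bar> = d" "x0 = (x1 + x2) / 2"
    and test: "most_powerful_test n (data_law m n t (null_image h x0))
        (data_law m n t (alternative_image h x1 x2)) \<alpha> \<Psi>"
      "(\<integral>y. \<Psi> y \<partial>data_law m n t (null_image h x0)) = \<alpha>"
      "(\<integral>y. \<Psi> y \<partial>data_law m n t (alternative_image h x1 x2)) = 1 - \<beta>"
    using assms(1) unfolding attains_errors_def by blast
  have "x1 = x0 - d / 2 \<and> x2 = x0 + d / 2 \<or> x1 = x0 + d / 2 \<and> x2 = x0 - d / 2"
    using x by (auto simp: abs_if field_simps split: if_splits)
  then have "alternative_image h x1 x2 = alternative_image h (x0 - d / 2) (x0 + d / 2)"
    by (auto simp: alternative_image_def add.commute)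
  with test show ?thesis unfolding errors_attained_def by auto
qed

text \<open>
  The quotient is the square root of \<open>\<surd>\<kappa> \<surd>I (d\<^sup>2 / 8) / Q\<close>; the constant \<open>2 \<surd>2\<close> is \<open>\<surd>8\<close>.
\<close>

lemma resolution_rate:
  fixes d \<kappa> :: "nat \<Rightarrow> real"
  assumes lim: "(\<lambda>t. sqrt (\<kappa> t) * sqrt I * ((d t)\<^sup>2 / 8)) \<longlonglongrightarrow> Q"
    and "0 < I" "0 < Q" and d: "\<forall>\<^sub>F t in sequentially. 0 < d t" and \<kappa>: "\<forall>\<^sub>F t in sequentially. 0 < \<kappa> t"
  shows "(\<lambda>t. d t / (2 * sqrt 2 * sqrt Q * I powr (- 1/4) * \<kappa> t powr (- 1/4))) \<longlonglongrightarrow> 1"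
proof -
  have "(\<lambda>t. sqrt (sqrt (\<kappa> t) * sqrt I * ((d t)\<^sup>2 / 8) / Q)) \<longlonglongrightarrow> sqrt (Q / Q)"
    using \<open>0 < Q\<close> by (intro tendsto_intros lim) simp
  moreover have "\<forall>\<^sub>F t in sequentially. sqrt (sqrt (\<kappa> t) * sqrt I * ((d t)\<^sup>2 / 8) / Q) =
      d t / (2 * sqrt 2 * sqrt Q * I powr (- 1/4) * \<kappa> t powr (- 1/4))"
    using d \<kappa>
  proof eventually_elim
    case (elim t)
    have root: "sqrt (sqrt x) = 1 / x powr (- 1/4)" if "0 < x" for x :: real
      using that by (simp add: powr_half_sqrt[symmetric] powr_powr powr_minus_divide)
    have "sqrt 8 = 2 * sqrt (2 :: real)" using real_sqrt_mult[of 4 2] by simp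
    then show ?case
      using elim \<open>0 < I\<close> \<open>0 < Q\<close> by (simp add: real_sqrt_mult real_sqrt_divide root)
  qed
  ultimately show ?thesis using \<open>0 < Q\<close> by (simp add: tendsto_cong)
qed

text \<open>
  The domains of smoothness supplied by the hypothesis shrink with \<open>d t\<close>. A single index \<open>t\<close> already
  gives a fixed neighbourhood, because \<open>h\<close> does not depend on \<open>t\<close>.
\<close>

lemma sources_smooth_neighbourhood:
  assumes d_lim: "d \<longlonglongrightarrow> 0" and d_pos: "\<forall>\<^sub>F t in sequentially. 0 < d t"
    and sources: "\<forall>\<^sub>F t in sequentially. \<bar>x1 t - x2 t\<bar> = d t \<and> x0 = (x1 t + x2 t) / 2"
    and Ck: "\<forall>\<^sub>F t in sequentially. \<forall>z\<in>{x0, x1 t, x2 t}. Ck_on 2 (\<lambda>x. h (x - z)) {0..1}"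
  obtains \<delta> where "0 < \<delta>" "\<And>y. - x0 - \<delta> \<le> y \<Longrightarrow> y \<le> 1 - x0 + \<delta> \<Longrightarrow> C2_at h y"
proof -
  have "\<forall>\<^sub>F t in sequentially. d t < 1" by (rule order_tendstoD[OF d_lim]) simp
  with d_pos sources Ck have "\<forall>\<^sub>F t in sequentially. \<exists>e. 0 < e \<and> e < 1 \<and>
      Ck_on 2 (\<lambda>x. h (x - x0)) {0..1} \<and> Ck_on 2 (\<lambda>x. h (x - (x0 - e))) {0..1} \<and>
      Ck_on 2 (\<lambda>x. h (x - (x0 + e))) {0..1}"
  proof eventually_elim
    case (elim t)
    have "x1 t = x0 - d t / 2 \<and> x2 t = x0 + d t / 2 \<or> x1 t = x0 + d t / 2 \<and> x2 t = x0 - d t / 2"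
      using elim(2) by (auto simp: abs_if field_simps split: if_splits)
    with elim show ?case by (intro exI[of _ "d t / 2"]) auto
  qed
  then obtain e where e: "0 < e" "e < 1"
      "Ck_on 2 (\<lambda>x. h (x - x0)) {0..1}" "Ck_on 2 (\<lambda>x. h (x - (x0 - e))) {0..1}"
      "Ck_on 2 (\<lambda>x. h (x - (x0 + e))) {0..1}"
    using eventually_happens[of _ sequentially] by auto
  show ?thesis
  proof (rule that[of "e / 2"])
    fix y assume "- x0 - e / 2 \<le> y" "y \<le> 1 - x0 + e / 2"
    with e(1) have "- x0 - e < y" "y < 1 - x0 + e" by linarith+
    then show "C2_at h y" by (rule C2_at_if_Ck_on_three_shifts[OF e(3-5) e(1,2)])
  qed (use e in simp)
qed

lemma source_split_perturbation:
  assumes "0 < \<delta>" and C2: "\<And>y. - x0 - \<delta> \<le> y \<Longrightarrow> y \<le> 1 - x0 + \<delta> \<Longrightarrow> C2_at h y"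
    and n: "filterlim n at_top sequentially"
    and d: "d \<longlonglongrightarrow> 0" and d_pos: "\<forall>\<^sub>F t in sequentially. 0 < d t"
  shows "image_perturbation (null_image h x0) (\<lambda>t. alternative_image h (x0 - d t / 2) (x0 + d t / 2))
    (\<lambda>x. deriv (deriv h) (x - x0)) (\<lambda>t. (d t)\<^sup>2 / 8) n"
proof
  let ?J = "{- x0 - \<delta>..1 - x0 + \<delta>}"
  have h: "continuous_on ?J h" and H: "continuous_on ?J (deriv (deriv h))"
    using C2 by (auto intro!: continuous_at_imp_continuous_on simp: C2_at_def) (metis DERIV_isCont)
  show "continuous_on {0..1} (null_image h x0)"
    unfolding null_image_def using \<open>0 < \<delta>\<close>
    by (intro continuous_on_compose2[OF h] continuous_intros) auto
  show "continuous_on {0..1} (\<lambda>x. deriv (deriv h) (x - x0))"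
    using \<open>0 < \<delta>\<close> by (intro continuous_on_compose2[OF H] continuous_intros) auto
  have "\<forall>\<^sub>F t in sequentially. d t < \<delta>" using \<open>0 < \<delta>\<close> by (intro order_tendstoD[OF d])
  with d_pos show "\<forall>\<^sub>F t in sequentially. continuous_on {0..1} (alternative_image h (x0 - d t / 2) (x0 + d t / 2))"
  proof eventually_elim
    case (elim t)
    then show ?case
      unfolding alternative_image_def
      by (intro continuous_intros continuous_on_compose2[OF h]) auto
  qed
  show "(\<lambda>t. (d t)\<^sup>2 / 8) \<longlonglongrightarrow> 0" by (auto intro!: tendsto_eq_intros d)
  show "\<forall>\<^sub>F t in sequentially. 0 < (d t)\<^sup>2 / 8" using d_pos by eventually_elim simp
  show "uniform_limit {0..1}
    (\<lambda>t x. (alternative_image h (x0 - d t / 2) (x0 + d t / 2) x - null_image h x0 x) / ((d t)\<^sup>2 / 8))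
    (\<lambda>x. deriv (deriv h) (x - x0)) sequentially"
    by (rule second_difference_uniform_limit[OF C2 \<open>0 < \<delta>\<close> d d_pos])
qed (rule n)

theorem theorem3p4:
  fixes h :: "real \<Rightarrow> real" and \<alpha> \<beta> x0 :: real
    and n :: "nat \<Rightarrow> nat" and d x1 x2 :: "nat \<Rightarrow> real"
  assumes "0 < \<alpha>" "\<alpha> < 1/2" and "0 < \<beta>" "\<beta> < 1/2"
    and "0 < x0" "x0 < 1"
    and h_nonneg: "\<And>x. 0 \<le> h x"
    and h_even: "\<And>x. h (- x) = h x"
    and h_nonconst: "\<not> (\<lambda>x. h (x - x0)) constant_on {0..1}"
    and n_lim: "filterlim n at_top sequentially"
    and d_lim: "d \<longlonglongrightarrow> 0"
    and sources: "\<forall>\<^sub>F t in sequentially.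
          x1 t \<in> {0<..<1} \<and> x2 t \<in> {0<..<1} \<and>
          \<bar>x1 t - x2 t\<bar> = d t \<and> x0 = (x1 t + x2 t) / 2"
  shows
    "((\<forall>\<^sub>F t in sequentially. is_statistical_resolution Poisson h x0 (n t) t \<alpha> \<beta> (d t)) \<and>
      (\<forall>\<^sub>F t in sequentially. \<forall>z\<in>{x0, x1 t, x2 t}.
         Ck_on 4 (\<lambda>x. h (x - z)) {0..1} \<and> (\<forall>x\<in>{0..1}. 0 < h (x - z)))
      \<longrightarrow> (\<lambda>t. d t /
            (2 * sqrt 2 * sqrt (std_normal_quantile (1 - \<beta>) - std_normal_quantile \<alpha>) *
             (integral {0..1} (\<lambda>x. (deriv (deriv h) (x - x0))\<^sup>2 / h (x - x0))) powr (- 1/4) *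
             real t powr (- 1/4))) \<longlonglongrightarrow> 1)
   \<and> ((\<forall>\<^sub>F t in sequentially.
         is_statistical_resolution Variance_Stabilized_Gaussian h x0 (n t) t \<alpha> \<beta> (d t)) \<and>
      (\<forall>\<^sub>F t in sequentially. \<forall>z\<in>{x0, x1 t, x2 t}.
         Ck_on 4 (\<lambda>x. h (x - z)) {0..1} \<and> (\<forall>x\<in>{0..1}. 0 < h (x - z)))
      \<longrightarrow> (\<lambda>t. d t /
            (2 * sqrt 2 * sqrt (std_normal_quantile (1 - \<beta>) - std_normal_quantile \<alpha>) *
             (integral {0..1} (\<lambda>x. (deriv (deriv h) (x - x0))\<^sup>2 / h (x - x0))) powr (- 1/4) *
             real t powr (- 1/4))) \<longlonglongrightarrow> 1)
   \<and> ((\<forall>\<^sub>F t in sequentially.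
         is_statistical_resolution Homogeneous_Gaussian h x0 (n t) t \<alpha> \<beta> (d t)) \<and>
      (\<lambda>t. real (n t)) \<in> o(\<lambda>t. (real t)\<^sup>2) \<and>
      (\<forall>\<^sub>F t in sequentially. \<forall>z\<in>{x0, x1 t, x2 t}. Ck_on 2 (\<lambda>x. h (x - z)) {0..1})
      \<longrightarrow> (\<lambda>t. d t /
            (2 * sqrt 2 * sqrt (std_normal_quantile (1 - \<beta>) - std_normal_quantile \<alpha>) *
             (integral {0..1} (\<lambda>x. (deriv (deriv h) (x - x0))\<^sup>2)) powr (- 1/4) *
             real t powr (- 1/2) * real (n t) powr (1/4))) \<longlonglongrightarrow> 1)"
proof -
  let ?Q = "std_normal_quantile (1 - \<beta>) - std_normal_quantile \<alpha>"
  have \<alpha>: "0 < \<alpha>" "\<alpha> < 1" and \<beta>: "0 < \<beta>" "\<beta> < 1" using assms by auto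
  have Q: "0 < ?Q" using std_normal_quantile_less[of \<alpha> "1 - \<beta>"] assms(1-4) by simp
  have t_pos: "\<forall>\<^sub>F t in sequentially. 0 < real t"
    using eventually_gt_at_top[of 0] by eventually_elim simp

  \<comment> \<open>In every model the resolution yields tests with the prescribed errors, and smoothness gives the
    perturbation expansion with a non-vanishing direction.\<close>
  have expansion: "(\<forall>\<^sub>F t in sequentially. 0 < d t) \<and>
      (\<forall>\<^sub>F t in sequentially. errors_attained m (n t) t (null_image h x0)
        (alternative_image h (x0 - d t / 2) (x0 + d t / 2)) \<alpha> \<beta>) \<and>
      image_perturbation (null_image h x0) (\<lambda>t. alternative_image h (x0 - d t / 2) (x0 + d t / 2))
        (\<lambda>x. deriv (deriv h) (x - x0)) (\<lambda>t. (d t)\<^sup>2 / 8) n \<and>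
      (\<exists>x\<in>{0..1}. deriv (deriv h) (x - x0) \<noteq> 0)"
    if res: "\<forall>\<^sub>F t in sequentially. is_statistical_resolution m h x0 (n t) t \<alpha> \<beta> (d t)"
      and Ck: "\<forall>\<^sub>F t in sequentially. \<forall>z\<in>{x0, x1 t, x2 t}. Ck_on 2 (\<lambda>x. h (x - z)) {0..1}" for m
  proof -
    have d_pos: "\<forall>\<^sub>F t in sequentially. 0 < d t"
      using res by eventually_elim (simp add: is_statistical_resolution_def)
    have "\<forall>\<^sub>F t in sequentially. \<bar>x1 t - x2 t\<bar> = d t \<and> x0 = (x1 t + x2 t) / 2"
      using sources by eventually_elim simp
    then obtain \<delta> where \<delta>: "0 < \<delta>" "\<And>y. - x0 - \<delta> \<le> y \<Longrightarrow> y \<le> 1 - x0 + \<delta> \<Longrightarrow> C2_at h y"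
      using sources_smooth_neighbourhood[OF d_lim d_pos _ Ck] by blast
    have "\<forall>\<^sub>F t in sequentially. errors_attained m (n t) t (null_image h x0)
        (alternative_image h (x0 - d t / 2) (x0 + d t / 2)) \<alpha> \<beta>"
      using res
      by eventually_elim (auto simp: is_statistical_resolution_def intro: attains_errors_imp_errors_attained)
    moreover have "\<exists>x\<in>{0..1}. deriv (deriv h) (x - x0) \<noteq> 0"
      using \<delta> by (intro even_second_derivative_nonzero[OF h_even assms(5,6) h_nonconst]) auto
    ultimately show ?thesis
      using d_pos source_split_perturbation[OF \<delta> n_lim d_lim d_pos] by blast
  qed

  have Ck4: "(\<forall>\<^sub>F t in sequentially. \<forall>z\<in>{x0, x1 t, x2 t}. Ck_on 2 (\<lambda>x. h (x - z)) {0..1}) \<and>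
      (\<forall>x\<in>{0..1}. 0 < null_image h x0 x)"
    if "\<forall>\<^sub>F t in sequentially. \<forall>z\<in>{x0, x1 t, x2 t}.
      Ck_on 4 (\<lambda>x. h (x - z)) {0..1} \<and> (\<forall>x\<in>{0..1}. 0 < h (x - z))"
  proof
    show "\<forall>\<^sub>F t in sequentially. \<forall>z\<in>{x0, x1 t, x2 t}. Ck_on 2 (\<lambda>x. h (x - z)) {0..1}"
      using that by eventually_elim (auto intro: Ck_on_mono)
    show "\<forall>x\<in>{0..1}. 0 < null_image h x0 x"
      using eventually_happens[OF that] by (auto simp: null_image_def)
  qed

  have poisson_and_stabilized: "(\<lambda>t. d t /
            (2 * sqrt 2 * sqrt ?Q *
             (integral {0..1} (\<lambda>x. (deriv (deriv h) (x - x0))\<^sup>2 / h (x - x0))) powr (- 1/4) *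
             real t powr (- 1/4))) \<longlonglongrightarrow> 1"
    if res: "\<forall>\<^sub>F t in sequentially. is_statistical_resolution m h x0 (n t) t \<alpha> \<beta> (d t)"
      and m: "m = Poisson \<or> m = Variance_Stabilized_Gaussian"
      and Ck: "\<forall>\<^sub>F t in sequentially. \<forall>z\<in>{x0, x1 t, x2 t}.
         Ck_on 4 (\<lambda>x. h (x - z)) {0..1} \<and> (\<forall>x\<in>{0..1}. 0 < h (x - z))" for m
  proof -
    note pos = Ck4[OF Ck, THEN conjunct2, rule_format]
    note S = expansion[OF res Ck4[OF Ck, THEN conjunct1]]
    interpret image_perturbation "null_image h x0" "\<lambda>t. alternative_image h (x0 - d t / 2) (x0 + d t / 2)"
      "\<lambda>x. deriv (deriv h) (x - x0)" "\<lambda>t. (d t)\<^sup>2 / 8" n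
      using S by blast
    let ?I = "integral {0..1} (\<lambda>x. (deriv (deriv h) (x - x0))\<^sup>2 / null_image h x0 x)"
    have I: "0 < ?I"
      using S by (intro integral_weighted_square_pos cont_G cont_f pos) auto
    have "(\<lambda>t. sqrt (real t) * sqrt ?I * ((d t)\<^sup>2 / 8)) \<longlonglongrightarrow> ?Q"
      using m poisson_limit[OF pos I \<alpha> \<beta>] variance_stabilized_gaussian_limit[OF pos I \<alpha> \<beta>] S by blast
    from resolution_rate[OF this I Q _ t_pos] S show ?thesis by (simp add: null_image_def)
  qed

  have homogeneous: "(\<lambda>t. d t /
            (2 * sqrt 2 * sqrt ?Q *
             (integral {0..1} (\<lambda>x. (deriv (deriv h) (x - x0))\<^sup>2)) powr (- 1/4) *
             real t powr (- 1/2) * real (n t) powr (1/4))) \<longlonglongrightarrow> 1"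
    if res: "\<forall>\<^sub>F t in sequentially. is_statistical_resolution Homogeneous_Gaussian h x0 (n t) t \<alpha> \<beta> (d t)"
      and Ck: "\<forall>\<^sub>F t in sequentially. \<forall>z\<in>{x0, x1 t, x2 t}. Ck_on 2 (\<lambda>x. h (x - z)) {0..1}"
  proof -
    note S = expansion[OF res Ck]
    interpret image_perturbation "null_image h x0" "\<lambda>t. alternative_image h (x0 - d t / 2) (x0 + d t / 2)"
      "\<lambda>x. deriv (deriv h) (x - x0)" "\<lambda>t. (d t)\<^sup>2 / 8" n
      using S by blast
    let ?I = "integral {0..1} (\<lambda>x. (deriv (deriv h) (x - x0))\<^sup>2)"
    have I: "0 < ?I"
      using integral_weighted_square_pos[OF cont_G, of "\<lambda>_. 1"] S by simp
    have \<kappa>: "\<forall>\<^sub>F t in sequentially. 0 < (real t)\<^sup>2 / real (n t)"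
      using t_pos n_pos by eventually_elim simp
    have "(\<lambda>t. sqrt ((real t)\<^sup>2 / real (n t)) * sqrt ?I * ((d t)\<^sup>2 / 8)) \<longlonglongrightarrow> ?Q"
      using S by (intro homogeneous_gaussian_limit[OF I \<alpha> \<beta>]) blast
    from resolution_rate[OF this I Q _ \<kappa>] S
    have "(\<lambda>t. d t / (2 * sqrt 2 * sqrt ?Q * ?I powr (- 1/4) * ((real t)\<^sup>2 / real (n t)) powr (- 1/4))) \<longlonglongrightarrow> 1"
      by blast
    moreover have "\<forall>\<^sub>F t in sequentially. ((real t)\<^sup>2 / real (n t)) powr (- 1/4)
        = real t powr (- 1/2) * real (n t) powr (1/4)"
      using t_pos n_pos
      by eventually_elim
        (simp add: powr_divide powr_powr powr_minus_divide flip: powr_numeral)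
    then have "\<forall>\<^sub>F t in sequentially.
        d t / (2 * sqrt 2 * sqrt ?Q * ?I powr (- 1/4) * ((real t)\<^sup>2 / real (n t)) powr (- 1/4)) =
        d t / (2 * sqrt 2 * sqrt ?Q * ?I powr (- 1/4) * real t powr (- 1/2) * real (n t) powr (1/4))"
      by eventually_elim (simp add: mult.assoc)
    ultimately show ?thesis by (simp only: tendsto_cong)
  qed

  show ?thesis
    using poisson_and_stabilized[of Poisson] poisson_and_stabilized[of Variance_Stabilized_Gaussian] homogeneous
    by blast
qed

end
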